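(* Let $\boldsymbol{T}$ be Hermitian, and suppose that $\omega\in\Omega_0$. Then the sequence $\{\boldsymbol{E}_{n|\omega}\}_{n=1}^\infty$ is relatively compact in $C(\mathbb{R}^2,\mathbb{C})$, and hence each sequence of positive integers contains a subsequence $\{n_k\}_{k=1}^\infty$ along which $\boldsymbol{E}_{n_k|\omega}$ converges in the norm of $C(\mathbb{R}^2,\mathbb{C})$.
   Context: $L^2=L^2(\mathbb{R})$ is the complex Hilbert space with inner product $\langle f,g\rangle=\int f(s)\overline{g(s)}\,ds$ (integrals without indicated domain are over $\mathbb{R}$, Lebesgue measure) and norm $\|\cdot\|$; $\mathfrak{R}(L^2)$ is the algebra of bounded linear operators $L^2\to L^2$. For a Banach space $B$ and $k\in\mathbb{N}$, $C(\mathbb{R}^k,B)$ is the Banach space, with the sup-norm, of continuous functions $f:\mathbb{R}^k\to B$ with $\|f(x)\|_B\to0$ as $|x|\to\infty$. A set in a normed space $Y$ is relatively compact if each sequence of its elements contains a subsequence converging in the norm of $Y$; a sequence is relatively compact if the set of its values is. $K^0$-kernels: a measurable function $\boldsymbol{K}:\mathbb{R}^2\to\mathbb{C}$, square integrable in each variable for almost every value of the other, is a $K^0$-kernel if (i) $\boldsymbol{K}\in C(\mathbb{R}^2,\mathbb{C})$; (ii) the Carleman function $\boldsymbol{k}(s)=\overline{\boldsymbol{K}(s,\cdot)}$ is in $C(\mathbb{R},L^2)$; (iii) the Carleman function $\boldsymbol{k}'(s)=\boldsymbol{K}(\cdot,s)$ is in $C(\mathbb{R},L^2)$. A kernel $\boldsymbol{K}$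 induces (is the kernel of) $K\in\mathfrak{R}(L^2)$ if $(Kf)(s)=\int\boldsymbol{K}(s,t)f(t)\,dt$ for every $f\in L^2$ and almost every $s$. Standing assumptions: $\boldsymbol{T}$ is a $K^0$-kernel inducing an operator $T\in\mathfrak{R}(L^2)$, and there are positive reals $\tau_n$ ($n\in\mathbb{N}$), strictly increasing to $\infty$, such that, with $\chi_n$ the characteristic function of $(-\tau_n,\tau_n)$ and $P_nf=\chi_nf$, for each $n$ the subkernels $\boldsymbol{T}_n(s,t)=\chi_n(s)\boldsymbol{T}(s,t)$ and $\widetilde{\boldsymbol{T}}_n(s,t)=\chi_n(s)\boldsymbol{T}(s,t)\chi_n(t)$ are $K^0$-kernels and the operators they induce, $T_n=P_nT$ and $\widetilde{T}_n=P_nTP_n$, are nuclear. Hermitian means $\boldsymbol{T}(s,t)=\overline{\boldsymbol{T}(t,s)}$ for all $s,t\in\mathbb{R}$; then all $\widetilde{\boldsymbol{T}}_n$ are Hermitian and $T$ and all $\widetilde{T}_n$ are self-adjoint. $\Omega_0$ is the collection of all Borel sets $\omega\subset\mathbb{R}$ whose closure in $\mathbb{R}$ does not contain $0$. For a self-adjoint operator $S$, $E_S(\cdot)$ is its resolution of the identity (projection-valued spectral measure on Borel subsets of $\mathbb{R}$). For $\omega\in\Omega_0$, $\boldsymbol{E}_{n|\omega}$ (the value at $\omega$ of the spectral function for $\widetilde{\boldsymbol{T}}_n$) is the $K^0$-kernel inducing the orthogonal projection $E_{\widetilde{T}_n}(\omega)$; explicitly $\boldsymbol{E}_{n|\omega}(s,t)=\langle\boldsymbol{e}_{n|\omega}(t),\boldsymbol{e}_{n|\omega}(s)\rangle$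 with $\boldsymbol{e}_{n|\omega}(s)=\overline{\boldsymbol{E}_{n|\omega}(s,\cdot)}=v_\omega(\widetilde{T}_n)(\widetilde{\boldsymbol{t}}_n(s))$, where $v_\omega(x)=1/x$ for $x\in\omega$, $v_\omega(x)=0$ otherwise, and $\widetilde{\boldsymbol{t}}_n(s)=\overline{\widetilde{\boldsymbol{T}}_n(s,\cdot)}$. *)

theory Defs
  imports "HOL-Analysis.Analysis"
begin

section \<open>The space of square integrable functions and its bounded operators\<close>

text \<open>
  Elements of the Hilbert space are represented by functions; two representatives
  of the same element agree almost everywhere, and equalities between elements
  are stated almost everywhere.
\<close>

definition L2 :: "(real \<Rightarrow> complex) set" where
  "L2 = {f. f \<in> borel_measurable lebesgue \<and> integrable lebesgue (\<lambda>s. (cmod (f s))\<^sup>2)}"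

definition L2_inner :: "(real \<Rightarrow> complex) \<Rightarrow> (real \<Rightarrow> complex) \<Rightarrow> complex" where
  "L2_inner f g = (LINT s|lebesgue. f s * cnj (g s))"

definition L2_norm :: "(real \<Rightarrow> complex) \<Rightarrow> real" where
  "L2_norm f = sqrt (LINT s|lebesgue. (cmod (f s))\<^sup>2)"

text \<open>
  Linearity and boundedness together force an operator to send functions that agree
  almost everywhere to functions that agree almost everywhere, so the operators
  below are exactly those induced by bounded linear operators on the quotient.
\<close>

definition L2_bounded_op :: "((real \<Rightarrow> complex) \<Rightarrow> (real \<Rightarrow> complex)) \<Rightarrow> bool" where
  "L2_bounded_op A \<longleftrightarrow>
     (\<forall>f\<in>L2. A f \<in> L2) \<and>
     (\<forall>f\<in>L2. \<forall>g\<in>L2. \<forall>a b. AE s in lebesgue.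
        A (\<lambda>r. a * f r + b * g r) s = a * A f s + b * A g s) \<and>
     (\<exists>C. \<forall>f\<in>L2. L2_norm (A f) \<le> C * L2_norm f)"

text \<open>
  Nuclearity: \<open>A\<close> is an absolutely convergent sum of operators of rank at most one.
\<close>

definition L2_nuclear :: "((real \<Rightarrow> complex) \<Rightarrow> (real \<Rightarrow> complex)) \<Rightarrow> bool" where
  "L2_nuclear A \<longleftrightarrow> L2_bounded_op A \<and>
     (\<exists>u v :: nat \<Rightarrow> real \<Rightarrow> complex.
        (\<forall>k. u k \<in> L2) \<and> (\<forall>k. v k \<in> L2) \<and>
        summable (\<lambda>k. L2_norm (u k) * L2_norm (v k)) \<and>
        (\<forall>f\<in>L2. (\<lambda>n. L2_norm (\<lambda>s. A f s - (\<Sum>k<n. L2_inner f (u k) * v k s)))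
                   \<longlonglongrightarrow> 0))"

definition L2_orthogonal_projection :: "((real \<Rightarrow> complex) \<Rightarrow> (real \<Rightarrow> complex)) \<Rightarrow> bool" where
  "L2_orthogonal_projection Q \<longleftrightarrow> L2_bounded_op Q \<and>
     (\<forall>f\<in>L2. AE s in lebesgue. Q (Q f) s = Q f s) \<and>
     (\<forall>f\<in>L2. \<forall>g\<in>L2. L2_inner (Q f) g = L2_inner f (Q g))"

definition cutoff :: "real \<Rightarrow> (real \<Rightarrow> complex) \<Rightarrow> (real \<Rightarrow> complex)" where
  "cutoff r f = (\<lambda>s. indicator {-r<..<r} s * f s)"


section \<open>Resolution of the identity\<close>

definition spectral_scalar_measure ::
    "(real set \<Rightarrow> (real \<Rightarrow> complex) \<Rightarrow> (real \<Rightarrow> complex)) \<Rightarrow> (real \<Rightarrow> complex) \<Rightarrow> real measure" where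
  "spectral_scalar_measure E f =
     measure_of UNIV (sets borel) (\<lambda>\<omega>. ennreal (Re (L2_inner (E \<omega> f) f)))"

text \<open>
  \<open>E\<close> is a projection-valued measure on the Borel sets of the line and
  \<open>S\<close> is the integral of the identity function against it. The latter is
  expressed by the quadratic forms \<open>\<langle>S f, f\<rangle> = \<integral> x d\<langle>E f, f\<rangle>\<close>, which
  determine \<open>S\<close> by polarization. The integrability clause cannot be dropped,
  because the integral of a non-integrable function is 0 by convention.
\<close>

definition resolution_of_identity ::
    "((real \<Rightarrow> complex) \<Rightarrow> (real \<Rightarrow> complex)) \<Rightarrow>
     (real set \<Rightarrow> (real \<Rightarrow> complex) \<Rightarrow> (real \<Rightarrow> complex)) \<Rightarrow> bool" where
  "resolution_of_identity S E \<longleftrightarrow>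
     (\<forall>\<omega>\<in>sets borel. L2_orthogonal_projection (E \<omega>)) \<and>
     (\<forall>f\<in>L2. AE s in lebesgue. E {} f s = 0) \<and>
     (\<forall>f\<in>L2. AE s in lebesgue. E UNIV f s = f s) \<and>
     (\<forall>\<omega>\<in>sets borel. \<forall>\<omega>'\<in>sets borel. \<forall>f\<in>L2.
        AE s in lebesgue. E (\<omega> \<inter> \<omega>') f s = E \<omega> (E \<omega>' f) s) \<and>
     (\<forall>A :: nat \<Rightarrow> real set. range A \<subseteq> sets borel \<longrightarrow> disjoint_family A \<longrightarrow>
        (\<forall>f\<in>L2. (\<lambda>n. L2_norm (\<lambda>s. E (\<Union>i. A i) f s - (\<Sum>i<n. E (A i) f s))) \<longlonglongrightarrow> 0)) \<and>
     (\<forall>f\<in>L2. integrable (spectral_scalar_measure E f) (\<lambda>x. x) \<and>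
        L2_inner (S f) f = complex_of_real (LINT x|spectral_scalar_measure E f. x))"

definition Omega0 :: "real set set" where
  "Omega0 = {\<omega>. \<omega> \<in> sets borel \<and> 0 \<notin> closure \<omega>}"


section \<open>Continuous functions vanishing at infinity\<close>

definition C0 :: "('a::real_normed_vector \<Rightarrow> 'b::real_normed_vector) set" where
  "C0 = {f. continuous_on UNIV f \<and> (f \<longlongrightarrow> 0) at_infinity}"

definition C0_norm :: "('a::real_normed_vector \<Rightarrow> 'b::real_normed_vector) \<Rightarrow> real" where
  "C0_norm f = (SUP x. norm (f x))"

definition C0_converges ::
    "(nat \<Rightarrow> 'a::real_normed_vector \<Rightarrow> 'b::real_normed_vector) \<Rightarrow> bool" where
  "C0_converges F \<longleftrightarrow> (\<exists>g\<in>C0. (\<lambda>k. C0_norm (\<lambda>x. F k x - g x)) \<longlonglongrightarrow> 0)"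

definition C0_relatively_compact ::
    "('a::real_normed_vector \<Rightarrow> 'b::real_normed_vector) set \<Rightarrow> bool" where
  "C0_relatively_compact X \<longleftrightarrow> X \<subseteq> C0 \<and>
     (\<forall>F :: nat \<Rightarrow> 'a \<Rightarrow> 'b. range F \<subseteq> X \<longrightarrow>
        (\<exists>r :: nat \<Rightarrow> nat. strict_mono r \<and> C0_converges (\<lambda>k. F (r k))))"

text \<open>
  The analogue of \<^term>\<open>C0\<close> for functions on the line with values in the Hilbert space,
  which is not a type.
\<close>

definition C0_L2 :: "(real \<Rightarrow> real \<Rightarrow> complex) set" where
  "C0_L2 = {k. (\<forall>s. k s \<in> L2) \<and>
               (\<forall>s. ((\<lambda>r. L2_norm (\<lambda>t. k r t - k s t)) \<longlongrightarrow> 0) (at s)) \<and>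
               ((\<lambda>s. L2_norm (k s)) \<longlongrightarrow> 0) at_infinity}"


section \<open>Kernels\<close>

definition K0_kernel :: "(real \<times> real \<Rightarrow> complex) \<Rightarrow> bool" where
  "K0_kernel K \<longleftrightarrow>
     K \<in> borel_measurable lebesgue \<and>
     (AE s in lebesgue. (\<lambda>t. K (s, t)) \<in> L2) \<and>
     (AE t in lebesgue. (\<lambda>s. K (s, t)) \<in> L2) \<and>
     K \<in> C0 \<and>
     (\<lambda>s t. cnj (K (s, t))) \<in> C0_L2 \<and>
     (\<lambda>s t. K (t, s)) \<in> C0_L2"

definition induces ::
    "(real \<times> real \<Rightarrow> complex) \<Rightarrow> ((real \<Rightarrow> complex) \<Rightarrow> (real \<Rightarrow> complex)) \<Rightarrow> bool" where
  "induces K A \<longleftrightarrow> L2_bounded_op A \<and>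
     (\<forall>f\<in>L2. AE s in lebesgue. A f s = (LINT t|lebesgue. K (s, t) * f t))"

definition hermitian_kernel :: "(real \<times> real \<Rightarrow> complex) \<Rightarrow> bool" where
  "hermitian_kernel K \<longleftrightarrow> (\<forall>s t. K (s, t) = cnj (K (t, s)))"

definition subkernel :: "real \<Rightarrow> (real \<times> real \<Rightarrow> complex) \<Rightarrow> (real \<times> real \<Rightarrow> complex)" where
  "subkernel r K = (\<lambda>(s, t). indicator {-r<..<r} s * K (s, t))"

definition subkernel_tilde :: "real \<Rightarrow> (real \<times> real \<Rightarrow> complex) \<Rightarrow> (real \<times> real \<Rightarrow> complex)" where
  "subkernel_tilde r K =
     (\<lambda>(s, t). indicator {-r<..<r} s * K (s, t) * indicator {-r<..<r} t)"

end

theory Submission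
  imports Defs "HOL-Complex_Analysis.Great_Picard"
begin

text \<open>
  Write \<open>S\<^sub>n = P\<^sub>n T P\<^sub>n\<close>, let \<open>Q\<^sub>n = E\<^sub>n(\<omega>)\<close> be the spectral projection, and choose \<open>d > 0\<close> with
  \<open>d \<le> \<bar>x\<bar>\<close> for all \<open>x \<in> \<omega>\<close>. The operator \<open>S\<^sub>n\<close> commutes with \<open>Q\<^sub>n\<close> and is bounded below by \<open>d\<close> on
  the range of \<open>Q\<^sub>n\<close>, so \<open>d \<parallel>Q\<^sub>n h\<parallel> \<le> \<parallel>S\<^sub>n h\<parallel>\<close> for every \<open>h\<close> (\<open>resolution_norm_le\<close>). This
  inequality takes the place of the bound \<open>\<parallel>v\<^sub>\<omega>(S\<^sub>n)\<parallel> \<le> 1 / d\<close> of the functional calculus.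

  An operator with a kernel \<open>K\<close> such that \<open>s \<mapsto> K(\<cdot>, s)\<close> is continuous into \<open>L\<^sup>2\<close> maps
  normalized indicators of intervals shrinking to \<open>s\<close> to functions that converge to the column
  \<open>K(\<cdot>, s)\<close> in \<open>L\<^sup>2\<close> (\<open>induces_approx_delta_tendsto\<close>). Applied to linear combinations of two such
  approximate point masses, the operator inequality becomes a bound of the columns of
  \<open>E\<^sub>n\<close>, and of the differences of two of its columns, by those of the kernel of \<open>S\<^sub>n\<close>
  (\<open>induces_column_norm_le\<close>). In the same way, idempotence and symmetry of \<open>Q\<^sub>n\<close> become the identity
  \<open>E\<^sub>n(s, t) = \<langle>E\<^sub>n(\<cdot>, t), E\<^sub>n(\<cdot>, s)\<rangle>\<close> at every point (\<open>projection_kernel_eq_inner\<close>).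

  It remains to bound the columns of the truncated kernels independently of \<open>n\<close>. Since the truncated
  kernel \<open>\<chi>\<^sub>n(s) T(s, t)\<close> is continuous, \<open>T\<close> vanishes on the lines \<open>s = \<plusminus>\<tau>\<^sub>n\<close>, and by symmetry
  on \<open>t = \<plusminus>\<tau>\<^sub>n\<close>. Hence the column at \<open>s\<close> of the doubly truncated kernel equals \<open>\<chi>\<^sub>n\<close> times
  the column of \<open>T\<close> at the point of \<open>[-\<tau>\<^sub>n, \<tau>\<^sub>n]\<close> nearest to \<open>s\<close>. Nearest-point projection does not increase
  distances, so the columns of all truncations inherit both the size and the modulus of
  continuity of \<open>s \<mapsto> T(\<cdot>, s)\<close>, which is uniformly continuous because it vanishes at infinity.
  The kernels \<open>E\<^sub>n\<close> are therefore uniformly bounded, equicontinuous, and uniformly small near infinity,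
  and the Arzela-Ascoli argument (\<open>C0_converges_subsequence\<close>) applies.
\<close>

section \<open>Square integrable functions\<close>

lemma borel_measurable_cnj [measurable]:
  "f \<in> borel_measurable M \<Longrightarrow> (\<lambda>x. cnj (f x)) \<in> borel_measurable M"
  by (rule measurable_compose[OF _ borel_measurable_continuous_onI]) (auto intro: continuous_intros)

lemma L2_measurable: "f \<in> L2 \<Longrightarrow> f \<in> borel_measurable lebesgue"
  by (simp add: L2_def)

lemma L2_integrable_square: "f \<in> L2 \<Longrightarrow> integrable lebesgue (\<lambda>s. (cmod (f s))\<^sup>2)"
  by (simp add: L2_def)

lemma L2_norm_nonneg [simp]: "0 \<le> L2_norm f"
  by (simp add: L2_norm_def)

lemma L2_norm_square: "(L2_norm f)\<^sup>2 = (LINT s|lebesgue. (cmod (f s))\<^sup>2)"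
  by (simp add: L2_norm_def)

lemma L2_lincomb:
  assumes "f \<in> L2" "g \<in> L2"
  shows "(\<lambda>s. a * f s + b * g s) \<in> L2"
proof -
  have [measurable]: "f \<in> borel_measurable lebesgue" "g \<in> borel_measurable lebesgue"
    using assms by (auto dest: L2_measurable)
  have bound: "(cmod (a * z + b * w))\<^sup>2 \<le> 2 * (cmod a)\<^sup>2 * (cmod z)\<^sup>2 + 2 * (cmod b)\<^sup>2 * (cmod w)\<^sup>2"
    for z w
  proof -
    have "(cmod (a * z + b * w))\<^sup>2 \<le> (cmod a * cmod z + cmod b * cmod w)\<^sup>2"
      by (metis norm_ge_zero norm_mult norm_triangle_ineq power_mono)
    also have "\<dots> \<le> 2 * (cmod a * cmod z)\<^sup>2 + 2 * (cmod b * cmod w)\<^sup>2"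
      using sum_squares_bound[of "cmod a * cmod z" "cmod b * cmod w"]
      by (simp add: power2_sum)
    finally show ?thesis by (simp add: power_mult_distrib mult.assoc)
  qed
  have "integrable lebesgue (\<lambda>s. (cmod (a * f s + b * g s))\<^sup>2)"
  proof (rule Bochner_Integration.integrable_bound)
    show "integrable lebesgue
            (\<lambda>s. 2 * (cmod a)\<^sup>2 * (cmod (f s))\<^sup>2 + 2 * (cmod b)\<^sup>2 * (cmod (g s))\<^sup>2)"
      using assms by (intro Bochner_Integration.integrable_add integrable_mult_right)
        (auto dest: L2_integrable_square)
    show "AE s in lebesgue. norm ((cmod (a * f s + b * g s))\<^sup>2)
            \<le> norm (2 * (cmod a)\<^sup>2 * (cmod (f s))\<^sup>2 + 2 * (cmod b)\<^sup>2 * (cmod (g s))\<^sup>2)"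
      using bound by (intro AE_I2) (simp add: abs_of_nonneg)
  qed measurable
  then show ?thesis by (simp add: L2_def)
qed

lemma L2_add: "f \<in> L2 \<Longrightarrow> g \<in> L2 \<Longrightarrow> (\<lambda>s. f s + g s) \<in> L2"
  using L2_lincomb[of f g 1 1] by simp

lemma L2_diff: "f \<in> L2 \<Longrightarrow> g \<in> L2 \<Longrightarrow> (\<lambda>s. f s - g s) \<in> L2"
  using L2_lincomb[of f g 1 "-1"] by simp

lemma L2_bounded_multiple:
  assumes "f \<in> L2" and [measurable]: "h \<in> borel_measurable lebesgue" and h: "\<And>s. cmod (h s) \<le> 1"
  shows "(\<lambda>s. h s * f s) \<in> L2" and "L2_norm (\<lambda>s. h s * f s) \<le> L2_norm f"
proof -
  have [measurable]: "f \<in> borel_measurable lebesgue" using assms by (auto dest: L2_measurable)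
  have le: "(cmod (h s * f s))\<^sup>2 \<le> (cmod (f s))\<^sup>2" for s
    using h[of s] by (intro power_mono) (auto simp: norm_mult intro: mult_left_le_one_le)
  have int: "integrable lebesgue (\<lambda>s. (cmod (h s * f s))\<^sup>2)"
    using le by (intro Bochner_Integration.integrable_bound[OF L2_integrable_square[OF assms(1)]]) auto
  then show "(\<lambda>s. h s * f s) \<in> L2" by (simp add: L2_def)
  show "L2_norm (\<lambda>s. h s * f s) \<le> L2_norm f"
    unfolding L2_norm_def
    by (intro real_sqrt_le_mono integral_mono int L2_integrable_square assms le)
qed

lemma L2_inner_integrable:
  assumes "f \<in> L2" "g \<in> L2"
  shows "integrable lebesgue (\<lambda>s. f s * cnj (g s))"
proof (rule Bochner_Integration.integrable_bound)
  have [measurable]: "f \<in> borel_measurable lebesgue" "g \<in> borel_measurable lebesgue"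
    using assms by (auto dest: L2_measurable)
  show "(\<lambda>s. f s * cnj (g s)) \<in> borel_measurable lebesgue" 
    by measurable
  show "integrable lebesgue (\<lambda>s. (cmod (f s))\<^sup>2 + (cmod (g s))\<^sup>2)"
    using assms by (intro Bochner_Integration.integrable_add) (auto dest: L2_integrable_square)
  have "x * y \<le> x\<^sup>2 + y\<^sup>2" if "0 \<le> x" "0 \<le> y" for x y :: real
    using sum_squares_bound[of x y] mult_nonneg_nonneg[OF that] by linarith
  then show "AE s in lebesgue. norm (f s * cnj (g s)) \<le> norm ((cmod (f s))\<^sup>2 + (cmod (g s))\<^sup>2)"
    by (intro AE_I2) (simp add: norm_mult abs_of_nonneg)
qed

lemma L2_inner_lincomb_left:
  assumes "f \<in> L2" "g \<in> L2" "h \<in> L2"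
  shows "L2_inner (\<lambda>s. a * f s + b * g s) h = a * L2_inner f h + b * L2_inner g h"
proof -
  have "(LINT s|lebesgue. (a * f s + b * g s) * cnj (h s))
      = (LINT s|lebesgue. a * (f s * cnj (h s)) + b * (g s * cnj (h s)))"
    by (simp add: algebra_simps)
  also have "\<dots> = a * L2_inner f h + b * L2_inner g h"
    unfolding L2_inner_def using assms
    by (subst Bochner_Integration.integral_add) (auto intro: L2_inner_integrable)
  finally show ?thesis by (simp add: L2_inner_def)
qed

lemma L2_inner_commute: "L2_inner g f = cnj (L2_inner f g)"
  unfolding L2_inner_def Bochner_Integration.integral_cnj [symmetric] by (simp add: mult.commute)

lemma L2_inner_lincomb_right:
  assumes "f \<in> L2" "g \<in> L2" "h \<in> L2"
  shows "L2_inner h (\<lambda>s. a * f s + b * g s) = cnj a * L2_inner h f + cnj b * L2_inner h g"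
  using L2_inner_lincomb_left[OF assms, of a b] L2_inner_commute[of h]
  by (metis complex_cnj_add complex_cnj_cnj complex_cnj_mult)

lemma L2_inner_add_left:
  "f \<in> L2 \<Longrightarrow> g \<in> L2 \<Longrightarrow> h \<in> L2 \<Longrightarrow> L2_inner (\<lambda>s. f s + g s) h = L2_inner f h + L2_inner g h"
  using L2_inner_lincomb_left[of f g h 1 1] by simp

lemma L2_inner_diff_left:
  "f \<in> L2 \<Longrightarrow> g \<in> L2 \<Longrightarrow> h \<in> L2 \<Longrightarrow> L2_inner (\<lambda>s. f s - g s) h = L2_inner f h - L2_inner g h"
  using L2_inner_lincomb_left[of f g h 1 "-1"] by simp

lemma L2_inner_diff_right:
  "f \<in> L2 \<Longrightarrow> g \<in> L2 \<Longrightarrow> h \<in> L2 \<Longrightarrow> L2_inner h (\<lambda>s. f s - g s) = L2_inner h f - L2_inner h g"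
  using L2_inner_lincomb_right[of f g h 1 "-1"] by simp

lemma L2_inner_self: "L2_inner f f = complex_of_real ((L2_norm f)\<^sup>2)"
  unfolding L2_inner_def L2_norm_square
  by (subst integral_complex_of_real [symmetric]) (simp add: complex_mult_cnj cmod_power2)

lemma L2_inner_cong:
  assumes "f \<in> L2" "f' \<in> L2" "g \<in> L2" "g' \<in> L2"
    and "AE s in lebesgue. f s = f' s" "AE s in lebesgue. g s = g' s"
  shows "L2_inner f g = L2_inner f' g'"
proof -
  have [measurable]: "f \<in> borel_measurable lebesgue" "g \<in> borel_measurable lebesgue"
    "f' \<in> borel_measurable lebesgue" "g' \<in> borel_measurable lebesgue"
    using assms by (auto dest: L2_measurable)
  show ?thesis unfolding L2_inner_def
  proof (rule integral_cong_AE)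
    show "AE x in lebesgue. f x * cnj (g x) = f' x * cnj (g' x)"
      using assms(5,6) by eventually_elim simp
  qed measurable
qed

lemma L2_norm_cong:
  assumes "f \<in> L2" "g \<in> L2" and "AE s in lebesgue. f s = g s"
  shows "L2_norm f = L2_norm g"
proof -
  have "complex_of_real ((L2_norm f)\<^sup>2) = complex_of_real ((L2_norm g)\<^sup>2)"
    using L2_inner_cong[of f g f g] assms L2_inner_self by metis
  then show ?thesis
    by (metis L2_norm_nonneg of_real_eq_iff power2_eq_imp_eq)
qed

text \<open>
  The law of cosines. Both the Cauchy-Schwarz inequality and the triangle inequality follow from it.
\<close>

lemma L2_norm_lincomb_square:
  assumes "f \<in> L2" "g \<in> L2"
  shows "(L2_norm (\<lambda>s. a * f s + b * g s))\<^sup>2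
       = (cmod a)\<^sup>2 * (L2_norm f)\<^sup>2 + 2 * Re (a * cnj b * L2_inner f g) + (cmod b)\<^sup>2 * (L2_norm g)\<^sup>2"
proof -
  let ?h = "\<lambda>s. a * f s + b * g s"
  have "complex_of_real ((L2_norm ?h)\<^sup>2) = a * L2_inner f ?h + b * L2_inner g ?h"
    unfolding L2_inner_self[symmetric] using assms L2_lincomb[OF assms]
    by (intro L2_inner_lincomb_left) auto
  also have "\<dots> = a * (cnj a * L2_inner f f + cnj b * L2_inner f g)
                  + b * (cnj a * cnj (L2_inner f g) + cnj b * L2_inner g g)"
    using assms by (simp add: L2_inner_lincomb_right L2_inner_commute[of g f])
  also have "\<dots> = complex_of_real ((cmod a)\<^sup>2 * (L2_norm f)\<^sup>2 + 2 * Re (a * cnj b * L2_inner f g)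
                       + (cmod b)\<^sup>2 * (L2_norm g)\<^sup>2)"
    by (simp only: L2_inner_self) (simp add: complex_eq_iff cmod_power2; simp add: algebra_simps power2_eq_square)
  finally show ?thesis by (simp only: of_real_eq_iff)
qed

lemma L2_Cauchy_Schwarz:
  assumes "f \<in> L2" "g \<in> L2"
  shows "cmod (L2_inner f g) \<le> L2_norm f * L2_norm g"
proof -
  \<comment> \<open>The square of \<open>\<parallel>t f - \<langle>f, g\<rangle> g\<parallel>\<close> is nonnegative for all real \<open>t\<close>; the choice \<open>t = \<parallel>g\<parallel>\<^sup>2\<close> gives the claim.\<close>
  let ?z = "L2_inner f g"
  have key: "0 \<le> t\<^sup>2 * (L2_norm f)\<^sup>2 - 2 * t * (cmod ?z)\<^sup>2 + (cmod ?z)\<^sup>2 * (L2_norm g)\<^sup>2" for t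
  proof -
    have "Re (complex_of_real t * cnj (- ?z) * ?z) = - t * (cmod ?z)\<^sup>2"
      by (simp add: cmod_power2) (simp add: algebra_simps power2_eq_square)
    then show ?thesis
      using L2_norm_lincomb_square[OF assms, of "complex_of_real t" "- ?z"]
        zero_le_power2[of "L2_norm (\<lambda>s. complex_of_real t * f s + - ?z * g s)"]
      by simp
  qed
  show ?thesis
  proof (cases "L2_norm g = 0 \<or> L2_norm f = 0")
    case False
    have "0 \<le> (L2_norm g)\<^sup>2 * ((L2_norm f)\<^sup>2 * (L2_norm g)\<^sup>2 - (cmod ?z)\<^sup>2)"
      using key[of "(L2_norm g)\<^sup>2"] by (simp add: algebra_simps power2_eq_square)
    then have "(cmod ?z)\<^sup>2 \<le> (L2_norm f * L2_norm g)\<^sup>2"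
      using False by (simp add: zero_le_mult_iff power_mult_distrib)
    then show ?thesis
      by (rule power2_le_imp_le) simp
  next
    case True
    \<comment> \<open>A factor of norm zero: large or small \<open>t\<close> in the same inequality forces \<open>\<langle>f, g\<rangle> = 0\<close>.\<close>
    have "?z = 0"
    proof (rule ccontr)
      assume z: "?z \<noteq> 0"
      show False
        using True
      proof
        assume "L2_norm f = 0"
        then have "0 \<le> (cmod ?z)\<^sup>2 * (- (L2_norm g)\<^sup>2 - 2)"
          using key[of "(L2_norm g)\<^sup>2 + 1"] by (simp add: algebra_simps)
        then have "0 \<le> - (L2_norm g)\<^sup>2 - 2"
          using z by (simp add: zero_le_mult_iff)
        then show False
          using zero_le_power2[of "L2_norm g"] by linarith
      next
        assume g: "L2_norm g = 0"
        have sm: "2 * t * (cmod ?z)\<^sup>2 \<le> t\<^sup>2 * (L2_norm f)\<^sup>2" for t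
          using key[of t] g by simp
        define t where "t = (cmod ?z)\<^sup>2 / ((L2_norm f)\<^sup>2 + 1)"
        have F: "(L2_norm f)\<^sup>2 + 1 > 0" by (smt (verit) zero_le_power2)
        have t: "t > 0" using z F by (simp add: t_def)
        then have "2 * (cmod ?z)\<^sup>2 \<le> t * (L2_norm f)\<^sup>2"
          using sm[of t] by (simp add: power2_eq_square mult.assoc)
        also have "\<dots> \<le> t * ((L2_norm f)\<^sup>2 + 1)" using t by simp
        also have "\<dots> = (cmod ?z)\<^sup>2" using F by (simp add: t_def)
        finally show False using z by simp
      qed
    qed
    then show ?thesis by simp
  qed
qed

lemma L2_norm_lincomb_le:
  assumes "f \<in> L2" "g \<in> L2"
  shows "L2_norm (\<lambda>s. a * f s + b * g s) \<le> cmod a * L2_norm f + cmod b * L2_norm g"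
proof (rule power2_le_imp_le)
  have "Re (a * cnj b * L2_inner f g) \<le> cmod (a * cnj b * L2_inner f g)"
    by (rule complex_Re_le_cmod)
  also have "\<dots> \<le> cmod a * cmod b * (L2_norm f * L2_norm g)"
    unfolding norm_mult complex_mod_cnj by (intro mult_left_mono L2_Cauchy_Schwarz assms) simp
  finally have "2 * Re (a * cnj b * L2_inner f g) \<le> 2 * (cmod a * L2_norm f) * (cmod b * L2_norm g)"
    by (simp only: mult_ac)
  then show "(L2_norm (\<lambda>s. a * f s + b * g s))\<^sup>2 \<le> (cmod a * L2_norm f + cmod b * L2_norm g)\<^sup>2"
    unfolding L2_norm_lincomb_square[OF assms] power2_sum power_mult_distrib by (simp only: add_ac add_le_cancel_left)
qed simp

lemma L2_norm_add_le: "f \<in> L2 \<Longrightarrow> g \<in> L2 \<Longrightarrow> L2_norm (\<lambda>s. f s + g s) \<le> L2_norm f + L2_norm g"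
  using L2_norm_lincomb_le[of f g 1 1] by simp

lemma L2_norm_diff_le: "f \<in> L2 \<Longrightarrow> g \<in> L2 \<Longrightarrow> L2_norm (\<lambda>s. f s - g s) \<le> L2_norm f + L2_norm g"
  using L2_norm_lincomb_le[of f g 1 "-1"] by simp

lemma L2_norm_minus_commute: "L2_norm (\<lambda>s. f s - g s) = L2_norm (\<lambda>s. g s - f s)"
  by (simp add: L2_norm_def norm_minus_commute)

lemma L2_norm_diff_triangle:
  assumes "f \<in> L2" "g \<in> L2" "h \<in> L2"
  shows "L2_norm (\<lambda>s. f s - h s) \<le> L2_norm (\<lambda>s. f s - g s) + L2_norm (\<lambda>s. g s - h s)"
  using L2_norm_add_le[OF L2_diff L2_diff, of f g g h] assms by simp

lemma L2_norm_triangle_diff: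
  assumes "f \<in> L2" "g \<in> L2"
  shows "L2_norm f \<le> L2_norm (\<lambda>s. f s - g s) + L2_norm g"
  using L2_norm_add_le[OF L2_diff, of f g g] assms by simp

lemma L2_norm_tendsto:
  assumes "\<And>n. F n \<in> L2" "f \<in> L2" "(\<lambda>n. L2_norm (\<lambda>x. F n x - f x)) \<longlonglongrightarrow> 0"
  shows "(\<lambda>n. L2_norm (F n)) \<longlonglongrightarrow> L2_norm f"
proof (rule LIM_zero_cancel, rule Lim_null_comparison[OF _ assms(3)], intro always_eventually allI)
  fix n
  show "norm (L2_norm (F n) - L2_norm f) \<le> L2_norm (\<lambda>x. F n x - f x)"
    using L2_norm_triangle_diff[OF assms(1)[of n] assms(2)]
      L2_norm_triangle_diff[OF assms(2) assms(1)[of n]] L2_norm_minus_commute[of f "F n"]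
    by simp
qed

lemma L2_inner_tendsto:
  assumes "\<And>n. F n \<in> L2" "f \<in> L2" "g \<in> L2" "(\<lambda>n. L2_norm (\<lambda>x. F n x - f x)) \<longlonglongrightarrow> 0"
  shows "(\<lambda>n. L2_inner (F n) g) \<longlonglongrightarrow> L2_inner f g"
proof (rule LIM_zero_cancel, rule Lim_null_comparison[OF _ tendsto_mult_left_zero[OF assms(4)]],
    intro always_eventually allI)
  fix n
  show "norm (L2_inner (F n) g - L2_inner f g) \<le> L2_norm (\<lambda>x. F n x - f x) * L2_norm g"
    using L2_Cauchy_Schwarz[OF L2_diff[OF assms(1)[of n] assms(2)] assms(3)] assms(1-3)
    by (simp add: L2_inner_diff_left)
qed

section \<open>Spectral projections away from zero\<close>

lemma L2_bounded_op_closed: "L2_bounded_op A \<Longrightarrow> f \<in> L2 \<Longrightarrow> A f \<in> L2"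
  by (simp add: L2_bounded_op_def)

lemma L2_bounded_op_lincomb:
  "L2_bounded_op A \<Longrightarrow> f \<in> L2 \<Longrightarrow> g \<in> L2 \<Longrightarrow>
     AE s in lebesgue. A (\<lambda>r. a * f r + b * g r) s = a * A f s + b * A g s"
  by (simp add: L2_bounded_op_def)

lemma L2_inner_bounded_op_lincomb:
  assumes "L2_bounded_op A" "f \<in> L2" "g \<in> L2" "h \<in> L2"
  shows "L2_inner (A (\<lambda>r. a * f r + b * g r)) h = a * L2_inner (A f) h + b * L2_inner (A g) h"
proof -
  have "L2_inner (A (\<lambda>r. a * f r + b * g r)) h = L2_inner (\<lambda>s. a * A f s + b * A g s) h"
    using assms(2-4)
    by (intro L2_inner_cong L2_bounded_op_closed[OF assms(1)] L2_lincomb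
        L2_bounded_op_lincomb[OF assms(1)]) auto
  also have "\<dots> = a * L2_inner (A f) h + b * L2_inner (A g) h"
    using assms by (intro L2_inner_lincomb_left L2_bounded_op_closed[OF assms(1)])
  finally show ?thesis .
qed

lemma L2_inner_form_lincomb:
  assumes "L2_bounded_op A" "p \<in> L2" "q \<in> L2"
  shows "L2_inner (A (\<lambda>r. p r + c * q r)) (\<lambda>r. p r + c * q r)
       = L2_inner (A p) p + cnj c * L2_inner (A p) q + c * L2_inner (A q) p
         + c * cnj c * L2_inner (A q) q"
proof -
  let ?u = "\<lambda>r. 1 * p r + c * q r"
  have u: "?u \<in> L2" using assms by (intro L2_lincomb)
  have "L2_inner (A ?u) ?u = 1 * L2_inner (A p) ?u + c * L2_inner (A q) ?u"
    using assms u by (intro L2_inner_bounded_op_lincomb)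
  also have "L2_inner (A p) ?u = cnj 1 * L2_inner (A p) p + cnj c * L2_inner (A p) q"
    using assms by (intro L2_inner_lincomb_right L2_bounded_op_closed[OF assms(1)])
  also have "L2_inner (A q) ?u = cnj 1 * L2_inner (A q) p + cnj c * L2_inner (A q) q"
    using assms by (intro L2_inner_lincomb_right L2_bounded_op_closed[OF assms(1)])
  finally show ?thesis by (simp add: algebra_simps)
qed

lemma resolution_projection:
  assumes "resolution_of_identity S E" "A \<in> sets borel"
  shows "L2_orthogonal_projection (E A)" "L2_bounded_op (E A)"
  using assms by (auto simp: resolution_of_identity_def L2_orthogonal_projection_def)

lemma resolution_closed:
  "resolution_of_identity S E \<Longrightarrow> A \<in> sets borel \<Longrightarrow> f \<in> L2 \<Longrightarrow> E A f \<in> L2"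
  using L2_bounded_op_closed[OF resolution_projection(2)] by blast

lemma resolution_selfadjoint:
  "resolution_of_identity S E \<Longrightarrow> A \<in> sets borel \<Longrightarrow> f \<in> L2 \<Longrightarrow> g \<in> L2 \<Longrightarrow>
     L2_inner (E A f) g = L2_inner f (E A g)"
  using resolution_projection(1)[of S E A] by (auto simp: L2_orthogonal_projection_def)

lemma resolution_inter:
  "resolution_of_identity S E \<Longrightarrow> A \<in> sets borel \<Longrightarrow> B \<in> sets borel \<Longrightarrow> f \<in> L2 \<Longrightarrow>
     AE s in lebesgue. E (A \<inter> B) f s = E A (E B f) s"
  by (simp add: resolution_of_identity_def)

lemma resolution_inner_empty:
  assumes "resolution_of_identity S E" "f \<in> L2" "g \<in> L2"
  shows "L2_inner (E {} f) g = 0"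
proof -
  have z: "(\<lambda>s. 0) \<in> L2" by (simp add: L2_def)
  have "L2_inner (E {} f) g = L2_inner (\<lambda>s. 0) g"
    using assms z by (intro L2_inner_cong resolution_closed[OF assms(1)])
      (auto simp: resolution_of_identity_def)
  then show ?thesis by (simp add: L2_inner_def)
qed

lemma resolution_inner_inter:
  assumes R: "resolution_of_identity S E" "A \<in> sets borel" "B \<in> sets borel" "f \<in> L2" "g \<in> L2"
  shows "L2_inner (E A (E B f)) g = L2_inner (E (A \<inter> B) f) g"
  using R resolution_inter[OF R(1-4)]
  by (intro L2_inner_cong resolution_closed[OF R(1)]) (auto elim: eventually_mono)

lemma resolution_inner_eq_norm:
  assumes R: "resolution_of_identity S E" "A \<in> sets borel" "f \<in> L2"
  shows "L2_inner (E A f) f = complex_of_real ((L2_norm (E A f))\<^sup>2)"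
  using resolution_inner_inter[OF R(1,2,2,3,3)]
    resolution_selfadjoint[OF R(1,2) resolution_closed[OF R] R(3)]
  by (simp add: L2_inner_self)

text \<open>
  Strong countable additivity of the projections passes to the quadratic form, because
  \<open>g \<mapsto> \<langle>g, f\<rangle>\<close> is continuous. This is what makes the spectral scalar measure a measure.
\<close>

lemma resolution_countably_additive:
  assumes R: "resolution_of_identity S E" "f \<in> L2"
    and A: "range A \<subseteq> sets borel" "disjoint_family A"
  shows "(\<lambda>i. Re (L2_inner (E (A i) f) f)) sums Re (L2_inner (E (\<Union>i. A i) f) f)"
proof -
  have meas: "A i \<in> sets borel" "(\<Union>i. A i) \<in> sets borel" for i using A by auto
  have sum_in: "(\<lambda>s. \<Sum>i<n. E (A i) f s) \<in> L2" for n
  proof (induction n)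
    case 0
    then show ?case by (simp add: L2_def)
  next
    case (Suc n)
    then show ?case using L2_add[OF Suc resolution_closed[OF R(1) meas(1) R(2)]] by simp
  qed
  have sum_inner: "L2_inner (\<lambda>s. \<Sum>i<n. E (A i) f s) f = (\<Sum>i<n. L2_inner (E (A i) f) f)" for n
  proof (induction n)
    case 0
    then show ?case by (simp add: L2_inner_def)
  next
    case (Suc n)
    then show ?case
      using L2_inner_add_left[OF sum_in[of n] resolution_closed[OF R(1) meas(1) R(2)] R(2)] by simp
  qed
  have U: "E (\<Union>i. A i) f \<in> L2" using R meas by (intro resolution_closed[OF R(1)])
  have "(\<lambda>n. L2_norm (\<lambda>s. E (\<Union>i. A i) f s - (\<Sum>i<n. E (A i) f s))) \<longlonglongrightarrow> 0"
    using R A by (auto simp: resolution_of_identity_def)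
  then have "(\<lambda>n. L2_norm (\<lambda>s. E (\<Union>i. A i) f s - (\<Sum>i<n. E (A i) f s)) * L2_norm f) \<longlonglongrightarrow> 0"
    using tendsto_mult_left_zero by blast
  then have "(\<lambda>n. L2_inner (\<lambda>s. E (\<Union>i. A i) f s - (\<Sum>i<n. E (A i) f s)) f) \<longlonglongrightarrow> 0"
    by (rule Lim_null_comparison[rotated])
      (auto intro!: always_eventually L2_Cauchy_Schwarz L2_diff U sum_in R)
  then have "(\<lambda>n. L2_inner (E (\<Union>i. A i) f) f - (\<Sum>i<n. L2_inner (E (A i) f) f)) \<longlonglongrightarrow> 0"
    using U sum_in R(2) by (simp add: L2_inner_diff_left sum_inner)
  then have "(\<lambda>n. \<Sum>i<n. L2_inner (E (A i) f) f) \<longlonglongrightarrow> L2_inner (E (\<Union>i. A i) f) f"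
    using tendsto_diff[OF tendsto_const, of _ 0 sequentially "L2_inner (E (\<Union>i. A i) f) f"] by fastforce
  then have "(\<lambda>i. L2_inner (E (A i) f) f) sums L2_inner (E (\<Union>i. A i) f) f"
    by (simp add: sums_def)
  then show ?thesis by (rule sums_Re)
qed

lemma sets_spectral_scalar_measure [simp]: "sets (spectral_scalar_measure E f) = sets borel"
  using sets.sigma_sets_eq[of "borel :: real measure"]
  by (simp add: spectral_scalar_measure_def sets_measure_of_conv)

lemma space_spectral_scalar_measure [simp]: "space (spectral_scalar_measure E f) = UNIV"
  by (simp add: spectral_scalar_measure_def space_measure_of_conv)

lemma emeasure_spectral_scalar_measure:
  assumes R: "resolution_of_identity S E" "f \<in> L2" and A: "A \<in> sets borel"
  shows "emeasure (spectral_scalar_measure E f) A = ennreal ((L2_norm (E A f))\<^sup>2)"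
proof -
  let ?\<mu> = "\<lambda>\<omega>. ennreal (Re (L2_inner (E \<omega> f) f))"
  have "emeasure (spectral_scalar_measure E f) A = ?\<mu> A"
  proof (rule emeasure_measure_of)
    show "spectral_scalar_measure E f = measure_of UNIV (sets borel) ?\<mu>"
      by (simp add: spectral_scalar_measure_def)
    show "positive (sets (spectral_scalar_measure E f)) ?\<mu>"
      using resolution_inner_empty[OF R R(2)] by (simp add: positive_def)
    show "countably_additive (sets (spectral_scalar_measure E f)) ?\<mu>"
    proof (rule countably_additiveI)
      fix B :: "nat \<Rightarrow> real set"
      assume B: "range B \<subseteq> sets (spectral_scalar_measure E f)" "disjoint_family B"
      have "0 \<le> Re (L2_inner (E (B i) f) f)" for i
        using R B by (subst resolution_inner_eq_norm[OF R(1)]) auto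
      then show "(\<Sum>i. ?\<mu> (B i)) = ?\<mu> (\<Union>i. B i)"
        using resolution_countably_additive[OF R, of B] B by (intro suminf_ennreal_eq) auto
    qed
  qed (use A in auto)
  then show ?thesis by (simp add: resolution_inner_eq_norm[OF R(1) A R(2)])
qed

text \<open>
  The integral is additive in the measure; this is needed because the scalar measure of an
  orthogonal sum of vectors is the sum of their scalar measures.
\<close>

lemma nn_integral_additive_measure:
  assumes "f \<in> borel_measurable M"
    and sets: "sets M1 = sets M" "sets M2 = sets M"
    and add: "\<And>A. A \<in> sets M \<Longrightarrow> emeasure M A = emeasure M1 A + emeasure M2 A"
  shows "(\<integral>\<^sup>+x. f x \<partial>M) = (\<integral>\<^sup>+x. f x \<partial>M1) + (\<integral>\<^sup>+x. f x \<partial>M2)"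
  using assms(1)
proof (induction rule: borel_measurable_induct)
  case (cong f g)
  have "space M1 = space M" "space M2 = space M" using sets by (auto dest: sets_eq_imp_space_eq)
  then have "integral\<^sup>N M1 f = integral\<^sup>N M1 g" "integral\<^sup>N M2 f = integral\<^sup>N M2 g"
    "integral\<^sup>N M f = integral\<^sup>N M g"
    using cong(3) by (auto intro!: nn_integral_cong)
  with cong(4) show ?case by simp
next
  case (set A)
  then show ?case using add sets by simp
next
  case (mult u c)
  then have "u \<in> borel_measurable M1" "u \<in> borel_measurable M2"
    by (simp_all add: measurable_cong_sets[OF sets(1) refl] measurable_cong_sets[OF sets(2) refl])
  with mult show ?case by (simp add: nn_integral_cmult distrib_left)
next
  case (add u v)
  then have "u \<in> borel_measurable M1" "u \<in> borel_measurable M2"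
    "v \<in> borel_measurable M1" "v \<in> borel_measurable M2"
    by (simp_all add: measurable_cong_sets[OF sets(1) refl] measurable_cong_sets[OF sets(2) refl])
  with add show ?case by (simp add: nn_integral_add algebra_simps)
next
  case (seq U)
  then have "U i \<in> borel_measurable M1" "U i \<in> borel_measurable M2" for i
    by (simp_all add: measurable_cong_sets[OF sets(1) refl] measurable_cong_sets[OF sets(2) refl])
  moreover have "incseq (\<lambda>i. \<integral>\<^sup>+ x. U i x \<partial>M1)" "incseq (\<lambda>i. \<integral>\<^sup>+ x. U i x \<partial>M2)"
    using \<open>incseq U\<close> by (auto intro!: nn_integral_mono simp: incseq_def le_fun_def)
  ultimately show ?case using seq
    by (simp add: nn_integral_monotone_convergence_SUP ennreal_SUP_add SUP_apply image_comp)
qed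

lemma integral_additive_measure:
  fixes f :: "'a \<Rightarrow> real"
  assumes int: "integrable M f" "integrable M1 f" "integrable M2 f"
    and sets: "sets M1 = sets M" "sets M2 = sets M"
    and add: "\<And>A. A \<in> sets M \<Longrightarrow> emeasure M A = emeasure M1 A + emeasure M2 A"
  shows "integral\<^sup>L M f = integral\<^sup>L M1 f + integral\<^sup>L M2 f"
proof -
  have [measurable]: "f \<in> borel_measurable M" using int by auto
  have fin: "(\<integral>\<^sup>+x. ennreal (f x) \<partial>N) < top" "(\<integral>\<^sup>+x. ennreal (- f x) \<partial>N) < top"
    if "integrable N f" for N
    using that by (auto simp: real_integrable_def less_top)
  have "(\<integral>\<^sup>+x. ennreal (f x) \<partial>M) = (\<integral>\<^sup>+x. ennreal (f x) \<partial>M1) + (\<integral>\<^sup>+x. ennreal (f x) \<partial>M2)"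
    by (rule nn_integral_additive_measure[OF _ sets add]) auto
  moreover have "(\<integral>\<^sup>+x. ennreal (- f x) \<partial>M)
      = (\<integral>\<^sup>+x. ennreal (- f x) \<partial>M1) + (\<integral>\<^sup>+x. ennreal (- f x) \<partial>M2)"
    by (rule nn_integral_additive_measure[OF _ sets add]) auto
  ultimately show ?thesis
    using fin[OF int(2)] fin[OF int(3)]
    by (simp add: real_lebesgue_integral_def[OF int(1)] real_lebesgue_integral_def[OF int(2)]
        real_lebesgue_integral_def[OF int(3)] enn2real_plus)
qed

text \<open>
  Since \<open>E(A)\<close> commutes with \<open>E(B)\<close>, the operator \<open>E(B)\<close> does not mix the range of \<open>E(A)\<close> with
  its orthogonal complement.
\<close>

lemma resolution_inner_cross:
  assumes R: "resolution_of_identity S E" and A: "A \<in> sets borel" and B: "B \<in> sets borel"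
    and h: "h \<in> L2"
  shows "L2_inner (E B (E A h)) (\<lambda>s. h s - E A h s) = 0"
    and "L2_inner (E B (\<lambda>s. h s - E A h s)) (E A h) = 0"
proof -
  note in_L2 = resolution_closed[OF R] L2_diff h A B
  have "L2_inner (E B (E A h)) (E A h) = L2_inner (E A (E B (E A h))) h"
    by (rule resolution_selfadjoint[OF R, symmetric]) (intro in_L2)+
  also have "\<dots> = L2_inner (E (A \<inter> B) (E A h)) h"
    by (rule resolution_inner_inter[OF R]) (intro in_L2)+
  also have "\<dots> = L2_inner (E ((A \<inter> B) \<inter> A) h) h"
    by (rule resolution_inner_inter[OF R]) (intro in_L2 sets.Int)+
  also have "(A \<inter> B) \<inter> A = B \<inter> A" by auto
  also have "L2_inner (E (B \<inter> A) h) h = L2_inner (E B (E A h)) h"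
    by (rule resolution_inner_inter[OF R, symmetric]) (intro in_L2)+
  finally have eq: "L2_inner (E B (E A h)) (E A h) = L2_inner (E B (E A h)) h" .
  show 1: "L2_inner (E B (E A h)) (\<lambda>s. h s - E A h s) = 0"
    by (subst L2_inner_diff_right) (simp_all add: eq in_L2)
  have "L2_inner (E B (\<lambda>s. h s - E A h s)) (E A h) = L2_inner (\<lambda>s. h s - E A h s) (E B (E A h))"
    by (rule resolution_selfadjoint[OF R]) (intro in_L2)+
  then show "L2_inner (E B (\<lambda>s. h s - E A h s)) (E A h) = 0"
    using 1 L2_inner_commute[of "E B (E A h)" "\<lambda>s. h s - E A h s"] by simp
qed

lemma resolution_integrable:
  "resolution_of_identity S E \<Longrightarrow> f \<in> L2 \<Longrightarrow> integrable (spectral_scalar_measure E f) (\<lambda>x. x)"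
  by (simp add: resolution_of_identity_def)

lemma resolution_form:
  "resolution_of_identity S E \<Longrightarrow> f \<in> L2 \<Longrightarrow>
     L2_inner (S f) f = complex_of_real (LINT x|spectral_scalar_measure E f. x)"
  by (simp add: resolution_of_identity_def)

text \<open>
  Only the quadratic form of \<open>S\<close> is given by the spectral integral, so that \<open>S\<close> commutes with \<open>E(A)\<close> has to
  be derived. With \<open>p = E(A) h\<close> and \<open>q = h - p\<close>, the scalar measure of \<open>p + c q\<close> is the sum of those of
  \<open>p\<close> and \<open>q\<close> whenever \<open>\<bar>c\<bar> = 1\<close>. Hence the form of \<open>S\<close> at \<open>p + c q\<close> has no cross terms, and the
  values \<open>c = 1\<close> and \<open>c = \<i>\<close> together give \<open>\<langle>S q, p\<rangle> = 0\<close>.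
\<close>

lemma resolution_inner_restricted:
  assumes R: "resolution_of_identity S E" and S: "L2_bounded_op S"
    and A: "A \<in> sets borel" and h: "h \<in> L2"
  shows "L2_inner (S h) (E A h) = complex_of_real (LINT x|spectral_scalar_measure E (E A h). x)"
proof -
  define p where "p = E A h"
  define q where "q = (\<lambda>s. h s - E A h s)"
  have p: "p \<in> L2" and q: "q \<in> L2"
    unfolding p_def q_def by (intro resolution_closed[OF R] L2_diff A h)+
  have form: "L2_inner (S (\<lambda>r. p r + c * q r)) (\<lambda>r. p r + c * q r) = L2_inner (S p) p + L2_inner (S q) q"
    if c: "c * cnj c = 1" for c
  proof -
    let ?u = "\<lambda>r. p r + c * q r"
    have u: "?u \<in> L2" using L2_lincomb[OF p q, of 1 c] by simp
    have "(L2_norm (E B ?u))\<^sup>2 = (L2_norm (E B p))\<^sup>2 + (L2_norm (E B q))\<^sup>2" if B: "B \<in> sets borel" for B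
    proof -
      have "L2_inner (E B ?u) ?u = L2_inner (E B p) p + L2_inner (E B q) q"
        using L2_inner_form_lincomb[OF resolution_projection(2)[OF R B] p q, of c]
          resolution_inner_cross[OF R A B h] c
        by (simp add: p_def q_def)
      then show ?thesis
        unfolding resolution_inner_eq_norm[OF R B u] resolution_inner_eq_norm[OF R B p]
          resolution_inner_eq_norm[OF R B q]
        by (metis of_real_add of_real_eq_iff)
    qed
    then have "(LINT x|spectral_scalar_measure E ?u. x)
        = (LINT x|spectral_scalar_measure E p. x) + (LINT x|spectral_scalar_measure E q. x)"
      by (intro integral_additive_measure resolution_integrable[OF R] u p q)
        (auto simp: emeasure_spectral_scalar_measure[OF R] u p q)
    then show ?thesis
      by (simp add: resolution_form[OF R] u p q)
  qed
  have cross: "cnj c * L2_inner (S p) q + c * L2_inner (S q) p = 0" if "c * cnj c = 1" for c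
    using form[OF that] L2_inner_form_lincomb[OF S p q, of c] that by simp
  have "L2_inner (S q) p = 0"
    using cross[of 1] cross[of \<i>] by (simp add: algebra_simps add_eq_0_iff)
  then have "L2_inner (S (\<lambda>r. 1 * p r + 1 * q r)) p = L2_inner (S p) p"
    by (subst L2_inner_bounded_op_lincomb[OF S p q p]) simp
  moreover have "(\<lambda>r. 1 * p r + 1 * q r) = h" by (simp add: p_def q_def)
  ultimately show ?thesis
    using resolution_form[OF R p] by (simp add: p_def)
qed

text \<open>
  The scalar measure of a vector in the range of \<open>E(A)\<close> lives on \<open>A\<close> because
  \<open>E(-A) E(A) = E({}) = 0\<close>.
\<close>

lemma spectral_scalar_measure_restricted:
  assumes R: "resolution_of_identity S E" and A: "A \<in> sets borel" and h: "h \<in> L2"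
  shows "AE x in spectral_scalar_measure E (E A h). x \<in> A"
    and "finite_measure (spectral_scalar_measure E (E A h))"
    and "measure (spectral_scalar_measure E (E A h)) UNIV = (L2_norm (E A h))\<^sup>2"
proof -
  let ?M = "spectral_scalar_measure E (E A h)"
  have p: "E A h \<in> L2" by (intro resolution_closed[OF R] A h)
  have "complex_of_real ((L2_norm (E (- A) (E A h)))\<^sup>2) = L2_inner (E (- A) (E A h)) (E A h)"
    by (rule resolution_inner_eq_norm[OF R _ p, symmetric]) (use A in auto)
  also have "\<dots> = L2_inner (E (- A \<inter> A) h) (E A h)"
    by (rule resolution_inner_inter[OF R]) (use A h p in auto)
  also have "\<dots> = 0" by (simp add: resolution_inner_empty[OF R h p])
  finally have "emeasure ?M (- A) = 0"
    using A by (subst emeasure_spectral_scalar_measure[OF R p]) (auto simp: of_real_eq_0_iff)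
  then show "AE x in ?M. x \<in> A"
    using A by (intro AE_I[of _ _ "- A"]) auto
  have "AE s in lebesgue. E UNIV (E A h) s = E A h s"
    using R p by (auto simp: resolution_of_identity_def)
  then have "L2_norm (E UNIV (E A h)) = L2_norm (E A h)"
    by (intro L2_norm_cong resolution_closed[OF R] p) auto
  then have total: "emeasure ?M UNIV = ennreal ((L2_norm (E A h))\<^sup>2)"
    by (simp add: emeasure_spectral_scalar_measure[OF R p])
  then show "finite_measure ?M" by (intro finite_measureI) simp
  show "measure ?M UNIV = (L2_norm (E A h))\<^sup>2" using total by (simp add: measure_def)
qed

text \<open>
  Split \<open>\<omega>\<close> at zero and let \<open>p\<close>, \<open>m\<close> be the components of \<open>h\<close> on the positive and the negative
  part. Testing \<open>S h\<close> against \<open>p - m\<close> turns \<open>x\<close> into \<open>\<bar>x\<bar> \<ge> d\<close>, so the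
  result is at least \<open>d (\<parallel>p\<parallel>\<^sup>2 + \<parallel>m\<parallel>\<^sup>2) = d \<parallel>E(\<omega>) h\<parallel>\<^sup>2\<close>, while \<open>\<parallel>p - m\<parallel> = \<parallel>E(\<omega>) h\<parallel>\<close>
  by orthogonality; Cauchy-Schwarz finishes.
\<close>

lemma resolution_norm_le:
  assumes R: "resolution_of_identity S E" and S: "L2_bounded_op S"
    and \<omega>: "\<omega> \<in> sets borel" and gap: "\<And>x. x \<in> \<omega> \<Longrightarrow> d \<le> \<bar>x\<bar>" and d: "0 < d"
    and h: "h \<in> L2"
  shows "d * L2_norm (E \<omega> h) \<le> L2_norm (S h)"
proof -
  let ?A = "\<omega> \<inter> {0..}" and ?B = "\<omega> \<inter> {..<0}"
  have AB: "?A \<in> sets borel" "?B \<in> sets borel" using \<omega> by auto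
  define p where "p = E ?A h"
  define m where "m = E ?B h"
  have p: "p \<in> L2" and m: "m \<in> L2"
    unfolding p_def m_def by (intro resolution_closed[OF R] AB h)+
  have pm: "(\<lambda>s. p s - m s) \<in> L2" by (intro L2_diff p m)
  have Sh: "S h \<in> L2" using S h by (rule L2_bounded_op_closed)
  have "emeasure (spectral_scalar_measure E h) (?A \<union> ?B)
      = emeasure (spectral_scalar_measure E h) ?A + emeasure (spectral_scalar_measure E h) ?B"
    by (rule plus_emeasure[symmetric]) (use \<omega> in auto)
  moreover have "?A \<union> ?B = \<omega>" by auto
  ultimately have split: "(L2_norm (E \<omega> h))\<^sup>2 = (L2_norm p)\<^sup>2 + (L2_norm m)\<^sup>2"
    using \<omega> by (simp add: emeasure_spectral_scalar_measure[OF R h] AB p_def m_def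
        ennreal_plus[symmetric] del: ennreal_plus)
  have "L2_inner p m = L2_inner (E ?B (E ?A h)) h"
    unfolding p_def m_def using p[unfolded p_def]
    by (intro resolution_selfadjoint[OF R, symmetric] AB h)
  also have "\<dots> = L2_inner (E (?B \<inter> ?A) h) h"
    by (rule resolution_inner_inter[OF R AB(2,1) h h])
  also have "?B \<inter> ?A = {}" by auto
  finally have "L2_inner p m = 0" by (simp add: resolution_inner_empty[OF R h h])
  then have "(L2_norm (\<lambda>s. p s - m s))\<^sup>2 = (L2_norm p)\<^sup>2 + (L2_norm m)\<^sup>2"
    using L2_norm_lincomb_square[OF p m, of 1 "-1"] by simp
  then have norm_pm: "L2_norm (\<lambda>s. p s - m s) = L2_norm (E \<omega> h)"
    using split by (metis L2_norm_nonneg power2_eq_imp_eq)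
  have "d * (L2_norm p)\<^sup>2 \<le> (LINT x|spectral_scalar_measure E p. x)"
  proof -
    interpret finite_measure "spectral_scalar_measure E p"
      unfolding p_def by (rule spectral_scalar_measure_restricted(2)[OF R AB(1) h])
    have "AE x in spectral_scalar_measure E p. d \<le> x"
      using spectral_scalar_measure_restricted(1)[OF R AB(1) h] unfolding p_def[symmetric]
    proof eventually_elim
      case (elim x)
      then show ?case using gap[of x] by auto
    qed
    then have "(LINT x|spectral_scalar_measure E p. d) \<le> (LINT x|spectral_scalar_measure E p. x)"
      by (intro integral_mono_AE resolution_integrable[OF R p]) auto
    then show ?thesis
      using spectral_scalar_measure_restricted(3)[OF R AB(1) h] by (simp add: p_def mult.commute)
  qed
  moreover have "(LINT x|spectral_scalar_measure E m. x) \<le> - d * (L2_norm m)\<^sup>2"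
  proof -
    interpret finite_measure "spectral_scalar_measure E m"
      unfolding m_def by (rule spectral_scalar_measure_restricted(2)[OF R AB(2) h])
    have "AE x in spectral_scalar_measure E m. x \<le> - d"
      using spectral_scalar_measure_restricted(1)[OF R AB(2) h] unfolding m_def[symmetric]
    proof eventually_elim
      case (elim x)
      then show ?case using gap[of x] by auto
    qed
    then have "(LINT x|spectral_scalar_measure E m. x) \<le> (LINT x|spectral_scalar_measure E m. - d)"
      by (intro integral_mono_AE resolution_integrable[OF R m]) auto
    then show ?thesis
      using spectral_scalar_measure_restricted(3)[OF R AB(2) h] by (simp add: m_def mult.commute)
  qed
  moreover have "Re (L2_inner (S h) (\<lambda>s. p s - m s))
      = (LINT x|spectral_scalar_measure E p. x) - (LINT x|spectral_scalar_measure E m. x)"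
    using resolution_inner_restricted[OF R S AB(1) h] resolution_inner_restricted[OF R S AB(2) h]
    by (simp add: L2_inner_diff_right Sh p m flip: p_def m_def)
  ultimately have "d * (L2_norm (E \<omega> h))\<^sup>2 \<le> Re (L2_inner (S h) (\<lambda>s. p s - m s))"
    using split by (simp add: algebra_simps)
  also have "\<dots> \<le> L2_norm (S h) * L2_norm (\<lambda>s. p s - m s)"
    using complex_Re_le_cmod L2_Cauchy_Schwarz[OF Sh pm] order_trans by blast
  finally have "(d * L2_norm (E \<omega> h)) * L2_norm (E \<omega> h) \<le> L2_norm (S h) * L2_norm (E \<omega> h)"
    by (simp add: norm_pm power2_eq_square mult.assoc)
  then show ?thesis
    by (cases "L2_norm (E \<omega> h) = 0") (auto simp: mult_le_cancel_right order.strict_iff_order)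
qed

section \<open>Recovering a kernel from its operator\<close>

definition window :: "nat \<Rightarrow> real \<Rightarrow> real set" where
  "window n s = {s - 1 / Suc n .. s + 1 / Suc n}"

definition approx_delta :: "nat \<Rightarrow> real \<Rightarrow> real \<Rightarrow> complex" where
  "approx_delta n s t = of_real (Suc n / 2) * indicator (window n s) t"

lemma mem_window: "t \<in> window n s \<longleftrightarrow> \<bar>t - s\<bar> \<le> 1 / Suc n"
  by (auto simp: window_def)

lemma window_borel [measurable, simp]: "window n s \<in> sets borel"
  by (simp add: window_def)

lemma emeasure_window: "emeasure lborel (window n s) = ennreal (2 / Suc n)"
  by (simp add: window_def emeasure_lborel_Icc_eq)

lemma integrable_indicator_window: "integrable lebesgue (indicat_real (window n s))"
  by (intro integrable_real_indicator) (auto simp: emeasure_window)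

lemma integral_window: "(LINT t|lebesgue. indicat_real (window n s) t) = 2 / Suc n"
  by (simp add: measure_def emeasure_window)

lemma indicator_window_in_L2: "(\<lambda>t. indicator (window n s) t) \<in> L2"
proof -
  have eq: "(\<lambda>t. (cmod (indicator (window n s) t))\<^sup>2) = indicat_real (window n s)"
    by (auto simp: indicator_def)
  have "(\<lambda>t. indicator (window n s) t :: complex) \<in> borel_measurable lebesgue"
    by (intro borel_measurable_indicator) simp
  then show ?thesis
    using integrable_indicator_window by (simp add: L2_def eq)
qed

lemma approx_delta_in_L2: "approx_delta n s \<in> L2"
  using L2_lincomb[OF indicator_window_in_L2 indicator_window_in_L2, of "of_real (Suc n / 2)" n s 0]
  by (simp add: approx_delta_def[abs_def])

lemma integrable_window:
  assumes "continuous_on UNIV (g :: real \<Rightarrow> complex)"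
  shows "integrable lebesgue (\<lambda>t. indicator (window n s) t * g t)"
proof -
  have "continuous_on (window n s) g" "compact (window n s)"
    using assms continuous_on_subset by (blast, simp add: window_def)
  then have "integrable lborel (\<lambda>t. indicator (window n s) t *\<^sub>R g t)"
    by (intro borel_integrable_compact)
  then have "integrable lebesgue (\<lambda>t. indicator (window n s) t *\<^sub>R g t)"
    by (subst integrable_completion) auto
  moreover have "(\<lambda>t. indicator (window n s) t *\<^sub>R g t) = (\<lambda>t. indicator (window n s) t * g t)"
    by (auto simp: indicator_def)
  ultimately show ?thesis by simp
qed

lemma window_in_L2:
  assumes "continuous_on UNIV (g :: real \<Rightarrow> complex)"
  shows "(\<lambda>t. indicator (window n s) t * g t) \<in> L2"
proof -
  have "continuous_on UNIV (\<lambda>t. complex_of_real ((cmod (g t))\<^sup>2))"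
    using assms by (intro continuous_intros)
  from integrable_Re[OF integrable_window[OF this, of n s]]
  have "integrable lebesgue (\<lambda>t. (cmod (indicator (window n s) t * g t))\<^sup>2)"
    by (rule Bochner_Integration.integrable_cong[THEN iffD1, rotated 2]) (auto simp: indicator_def)
  moreover have "(\<lambda>t. indicator (window n s) t * g t) \<in> borel_measurable lebesgue"
    using integrable_window[OF assms] by (rule borel_measurable_integrable)
  ultimately show ?thesis by (simp add: L2_def)
qed

lemma approx_delta_average_diff:
  assumes g: "continuous_on UNIV (g :: real \<Rightarrow> complex)"
  shows "(LINT t|lebesgue. g t * approx_delta n s t) - g s
       = of_real (Suc n / 2) * (LINT t|lebesgue. indicator (window n s) t * (g t - g s))"
proof -
  have const: "(LINT t|lebesgue. indicator (window n s) t * g s) = of_real (2 / Suc n) * g s"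
  proof -
    have "(LINT t|lebesgue. indicator (window n s) t * g s)
        = (LINT t|lebesgue. complex_of_real (indicat_real (window n s) t)) * g s"
      by (simp add: of_real_indicator)
    then show ?thesis by (simp only: integral_complex_of_real integral_window)
  qed
  have "(LINT t|lebesgue. indicator (window n s) t * (g t - g s))
      = (LINT t|lebesgue. indicator (window n s) t * g t - indicator (window n s) t * g s)"
    by (simp add: right_diff_distrib)
  also have "\<dots> = (LINT t|lebesgue. indicator (window n s) t * g t) - of_real (2 / Suc n) * g s"
    unfolding const[symmetric]
    by (rule Bochner_Integration.integral_diff) (intro integrable_window g continuous_intros)+
  finally have "of_real (Suc n / 2) * (LINT t|lebesgue. indicator (window n s) t * (g t - g s))
      = of_real (Suc n / 2) * (LINT t|lebesgue. indicator (window n s) t * g t)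
        - of_real (Suc n / 2) * of_real (2 / Suc n) * g s"
    by (simp only: right_diff_distrib mult.assoc)
  also have "of_real (Suc n / 2) * of_real (2 / Suc n) * g s = g s"
  proof -
    have "real (Suc n) / 2 * (2 / real (Suc n)) = 1" by simp
    then show ?thesis by (simp only: of_real_mult[symmetric] of_real_1 mult_1)
  qed
  also have "of_real (Suc n / 2) * (LINT t|lebesgue. indicator (window n s) t * g t)
      = (LINT t|lebesgue. g t * approx_delta n s t)"
    by (subst Bochner_Integration.integral_mult_right_zero[symmetric]) (simp add: approx_delta_def mult_ac)
  finally show ?thesis by simp
qed

text \<open>
  Jensen's inequality for the uniform distribution on the window, obtained from Cauchy-Schwarz
  against the indicator of the window.
\<close>

lemma approx_delta_average_square_le:
  assumes g: "continuous_on UNIV (g :: real \<Rightarrow> complex)"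
  shows "(cmod ((LINT t|lebesgue. g t * approx_delta n s t) - g s))\<^sup>2
       \<le> Suc n / 2 * (LINT t|lebesgue. (cmod (indicator (window n s) t * (g t - g s)))\<^sup>2)"
proof -
  let ?I = "\<lambda>t. indicator (window n s) t :: complex"
  let ?h = "\<lambda>t. ?I t * (g t - g s)"
  have h: "?h \<in> L2" by (intro window_in_L2 continuous_intros g)
  have "(LINT t|lebesgue. ?h t) = L2_inner ?h ?I"
    unfolding L2_inner_def by (rule Bochner_Integration.integral_cong) (auto simp: indicator_def)
  then have "cmod (LINT t|lebesgue. ?h t) \<le> L2_norm ?h * L2_norm ?I"
    using L2_Cauchy_Schwarz[OF h indicator_window_in_L2] by simp
  then have "(cmod (LINT t|lebesgue. ?h t))\<^sup>2 \<le> (L2_norm ?h)\<^sup>2 * (L2_norm ?I)\<^sup>2"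
    unfolding power_mult_distrib[symmetric] by (rule power_mono) simp
  also have "(L2_norm ?I)\<^sup>2 = 2 / Suc n"
  proof -
    have "(\<lambda>t. (cmod (?I t))\<^sup>2) = indicat_real (window n s)" by (auto simp: indicator_def)
    then show ?thesis by (simp only: L2_norm_square integral_window)
  qed
  finally have "(Suc n / 2)\<^sup>2 * (cmod (LINT t|lebesgue. ?h t))\<^sup>2 \<le> (Suc n / 2)\<^sup>2 * ((L2_norm ?h)\<^sup>2 * (2 / Suc n))"
    by (intro mult_left_mono) auto
  also have "\<dots> = Suc n / 2 * (L2_norm ?h)\<^sup>2" by (simp add: power2_eq_square field_simps)
  finally show ?thesis
    unfolding approx_delta_average_diff[OF g] norm_mult power_mult_distrib norm_of_real L2_norm_square by simp
qed

lemma approx_delta_average_tendsto: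
  assumes g: "continuous_on UNIV (g :: real \<Rightarrow> complex)"
  shows "(\<lambda>n. LINT t|lebesgue. g t * approx_delta n s t) \<longlonglongrightarrow> g s"
  unfolding lim_sequentially
proof (intro allI impI)
  fix e :: real assume e: "e > 0"
  obtain d where d: "d > 0" "\<And>t. \<bar>t - s\<bar> < d \<Longrightarrow> cmod (g t - g s) < e / 2"
    using g e unfolding continuous_on_iff dist_norm by (metis UNIV_I half_gt_zero real_norm_def)
  obtain N where N: "1 / real (Suc N) < d" using d(1) nat_approx_posE by blast
  have "dist (LINT t|lebesgue. g t * approx_delta n s t) (g s) < e" if n: "n \<ge> N" for n
  proof -
    have "1 / real (Suc n) \<le> 1 / real (Suc N)" using n by (simp add: frac_le)
    then have small: "cmod (g t - g s) \<le> e / 2" if "t \<in> window n s" for t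
      using that N by (intro less_imp_le d(2)) (auto simp: mem_window)
    have "cmod (LINT t|lebesgue. indicator (window n s) t * (g t - g s))
        \<le> (LINT t|lebesgue. (e / 2) * indicat_real (window n s) t)"
    proof (rule Bochner_Integration.integral_norm_bound_integral)
      show "integrable lebesgue (\<lambda>t. indicator (window n s) t * (g t - g s))"
        by (intro integrable_window continuous_intros g)
      show "integrable lebesgue (\<lambda>t. (e / 2) * indicat_real (window n s) t)"
        by (intro integrable_mult_right integrable_indicator_window)
      show "cmod (indicator (window n s) t * (g t - g s)) \<le> (e / 2) * indicat_real (window n s) t" for t
        using small[of t] by (cases "t \<in> window n s") auto
    qed
    also have "\<dots> = (e / 2) * (2 / Suc n)"
      by (simp only: Bochner_Integration.integral_mult_right_zero integral_window)
    finally have "Suc n / 2 * cmod (LINT t|lebesgue. indicator (window n s) t * (g t - g s))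
        \<le> Suc n / 2 * ((e / 2) * (2 / Suc n))"
      by (intro mult_left_mono) auto
    also have "\<dots> = e / 2" by (simp add: field_simps)
    finally have "cmod (of_real (Suc n / 2) * (LINT t|lebesgue. indicator (window n s) t * (g t - g s))) \<le> e / 2"
      unfolding norm_mult norm_of_real by simp
    then show ?thesis
      using e unfolding dist_norm approx_delta_average_diff[OF g] by linarith
  qed
  then show "\<exists>N. \<forall>n\<ge>N. dist (LINT t|lebesgue. g t * approx_delta n s t) (g s) < e" by blast
qed

lemma K0_kernel_continuous: "K0_kernel K \<Longrightarrow> continuous_on UNIV K"
  by (simp add: K0_kernel_def C0_def)

lemma K0_kernel_column: "K0_kernel K \<Longrightarrow> (\<lambda>x. K (x, s)) \<in> L2"
  by (simp add: K0_kernel_def C0_L2_def)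

lemma K0_kernel_column_continuous:
  "K0_kernel K \<Longrightarrow> ((\<lambda>r. L2_norm (\<lambda>x. K (x, r) - K (x, s))) \<longlongrightarrow> 0) (at s)"
  by (simp add: K0_kernel_def C0_L2_def)

lemma induces_bounded_op: "induces K A \<Longrightarrow> L2_bounded_op A"
  by (simp add: induces_def)

text \<open>
  The deviation of \<open>A \<delta>\<^sub>n\<close> from the column at \<open>s\<close> is the average of the deviations of the nearby
  columns. Jensen's inequality bounds its square pointwise, and by Tonelli the \<open>L\<^sup>2\<close> norm of an average is
  at most the largest of the averaged norms.
\<close>

lemma induces_approx_delta_norm_le:
  assumes K: "K0_kernel K" and A: "induces K A"
    and close: "\<And>t. t \<in> window n s \<Longrightarrow> L2_norm (\<lambda>x. K (x, t) - K (x, s)) \<le> \<eta>"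
  shows "L2_norm (\<lambda>x. A (approx_delta n s) x - K (x, s)) \<le> \<eta>"
proof -
  have cont: "continuous_on UNIV K" using K by (rule K0_kernel_continuous)
  have cont_row: "continuous_on UNIV (\<lambda>t. K (x, t))" for x
    by (intro continuous_on_compose2[OF cont] continuous_intros) auto
  have D: "(\<lambda>x. A (approx_delta n s) x - K (x, s)) \<in> L2"
    by (intro L2_diff L2_bounded_op_closed[OF induces_bounded_op[OF A]] approx_delta_in_L2 K0_kernel_column K)
  define G where "G = (\<lambda>x t. indicator (window n s) t * ennreal ((cmod (K (x, t) - K (x, s)))\<^sup>2))"
  have [measurable]: "K \<in> borel_measurable (borel \<Otimes>\<^sub>M borel)"
    using cont by (simp add: borel_prod borel_measurable_continuous_onI)
  have G_meas: "(\<lambda>(x, t). G x t) \<in> borel_measurable (lborel \<Otimes>\<^sub>M lborel)"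
    unfolding G_def by measurable
  have pointwise: "ennreal ((cmod ((LINT t|lebesgue. K (x, t) * approx_delta n s t) - K (x, s)))\<^sup>2)
      \<le> ennreal (Suc n / 2) * (\<integral>\<^sup>+t. G x t \<partial>lborel)" for x
  proof -
    have h: "(\<lambda>t. indicator (window n s) t * (K (x, t) - K (x, s))) \<in> L2"
      by (intro window_in_L2 continuous_intros cont_row)
    have "ennreal ((cmod ((LINT t|lebesgue. K (x, t) * approx_delta n s t) - K (x, s)))\<^sup>2)
        \<le> ennreal (Suc n / 2 * (LINT t|lebesgue. (cmod (indicator (window n s) t * (K (x, t) - K (x, s))))\<^sup>2))"
      by (intro ennreal_leI approx_delta_average_square_le cont_row)
    also have "\<dots> = ennreal (Suc n / 2)
        * ennreal (LINT t|lebesgue. (cmod (indicator (window n s) t * (K (x, t) - K (x, s))))\<^sup>2)"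
      by (rule ennreal_mult') simp
    also have "ennreal (LINT t|lebesgue. (cmod (indicator (window n s) t * (K (x, t) - K (x, s))))\<^sup>2)
        = (\<integral>\<^sup>+t. ennreal ((cmod (indicator (window n s) t * (K (x, t) - K (x, s))))\<^sup>2) \<partial>lebesgue)"
      by (rule nn_integral_eq_integral[symmetric]) (rule L2_integrable_square[OF h], simp)
    also have "\<dots> = (\<integral>\<^sup>+t. G x t \<partial>lborel)"
      unfolding nn_integral_completion G_def
      by (intro nn_integral_cong) (auto simp: indicator_def)
    finally show ?thesis .
  qed
  have "ennreal ((L2_norm (\<lambda>x. A (approx_delta n s) x - K (x, s)))\<^sup>2)
      = (\<integral>\<^sup>+x. ennreal ((cmod (A (approx_delta n s) x - K (x, s)))\<^sup>2) \<partial>lebesgue)"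
    unfolding L2_norm_square
    by (rule nn_integral_eq_integral[symmetric]) (rule L2_integrable_square[OF D], simp)
  also have "\<dots> \<le> (\<integral>\<^sup>+x. ennreal (Suc n / 2) * (\<integral>\<^sup>+t. G x t \<partial>lborel) \<partial>lebesgue)"
  proof (rule nn_integral_mono_AE)
    have "AE x in lebesgue. A (approx_delta n s) x = (LINT t|lebesgue. K (x, t) * approx_delta n s t)"
      using A approx_delta_in_L2 by (simp add: induces_def)
    then show "AE x in lebesgue. ennreal ((cmod (A (approx_delta n s) x - K (x, s)))\<^sup>2)
        \<le> ennreal (Suc n / 2) * (\<integral>\<^sup>+t. G x t \<partial>lborel)"
    proof eventually_elim
      case (elim x)
      then show ?case using pointwise[of x] by simp
    qed
  qed
  also have "\<dots> = (\<integral>\<^sup>+x. ennreal (Suc n / 2) * (\<integral>\<^sup>+t. G x t \<partial>lborel) \<partial>lborel)"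
    by (rule nn_integral_completion)
  also have "\<dots> = ennreal (Suc n / 2) * (\<integral>\<^sup>+x. (\<integral>\<^sup>+t. G x t \<partial>lborel) \<partial>lborel)"
    by (rule nn_integral_cmult)
      (use lborel.borel_measurable_nn_integral[OF G_meas] in simp)
  also have "(\<integral>\<^sup>+x. (\<integral>\<^sup>+t. G x t \<partial>lborel) \<partial>lborel) = (\<integral>\<^sup>+t. (\<integral>\<^sup>+x. G x t \<partial>lborel) \<partial>lborel)"
    by (rule lborel_pair.Fubini'[OF G_meas, symmetric])
  also have "\<dots> \<le> (\<integral>\<^sup>+t. ennreal (\<eta>\<^sup>2) * indicator (window n s) t \<partial>lborel)"
  proof (rule nn_integral_mono)
    fix t
    show "(\<integral>\<^sup>+x. G x t \<partial>lborel) \<le> ennreal (\<eta>\<^sup>2) * indicator (window n s) t"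
    proof (cases "t \<in> window n s")
      case True
      have d: "(\<lambda>x. K (x, t) - K (x, s)) \<in> L2" by (intro L2_diff K0_kernel_column K)
      have "(\<integral>\<^sup>+x. G x t \<partial>lborel) = (\<integral>\<^sup>+x. ennreal ((cmod (K (x, t) - K (x, s)))\<^sup>2) \<partial>lebesgue)"
        using True by (simp add: G_def nn_integral_completion)
      also have "\<dots> = ennreal ((L2_norm (\<lambda>x. K (x, t) - K (x, s)))\<^sup>2)"
        unfolding L2_norm_square
        by (rule nn_integral_eq_integral) (rule L2_integrable_square[OF d], simp)
      also have "\<dots> \<le> ennreal (\<eta>\<^sup>2)"
        by (intro ennreal_leI power_mono close True) simp
      finally show ?thesis using True by simp
    qed (simp add: G_def)
  qed
  also have "\<dots> = ennreal (\<eta>\<^sup>2 * (2 / Suc n))"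
    by (subst nn_integral_cmult_indicator) (simp_all only: emeasure_window ennreal_mult' zero_le_power2
        sets_lborel window_borel divide_nonneg_nonneg of_nat_0_le_iff zero_le_numeral)
  finally have "ennreal ((L2_norm (\<lambda>x. A (approx_delta n s) x - K (x, s)))\<^sup>2)
      \<le> ennreal (Suc n / 2 * (\<eta>\<^sup>2 * (2 / Suc n)))"
    by (simp only: ennreal_mult' divide_nonneg_nonneg of_nat_0_le_iff zero_le_numeral)
       (simp add: mult_left_mono)
  also have "Suc n / 2 * (\<eta>\<^sup>2 * (2 / Suc n)) = \<eta>\<^sup>2" by (simp add: field_simps)
  finally have "(L2_norm (\<lambda>x. A (approx_delta n s) x - K (x, s)))\<^sup>2 \<le> \<eta>\<^sup>2" by simp
  moreover have "0 \<le> \<eta>" using close[of s] L2_norm_nonneg[of "\<lambda>x. K (x, s) - K (x, s)"]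
    by (simp only: mem_window) (simp add: L2_norm_def)
  ultimately show ?thesis by (rule power2_le_imp_le)
qed

lemma induces_approx_delta_tendsto:
  assumes K: "K0_kernel K" and A: "induces K A"
  shows "(\<lambda>n. L2_norm (\<lambda>x. A (approx_delta n s) x - K (x, s))) \<longlonglongrightarrow> 0"
  unfolding lim_sequentially
proof (intro allI impI)
  fix e :: real assume e: "e > 0"
  obtain d where d: "d > 0"
    "\<And>t. t \<noteq> s \<Longrightarrow> \<bar>t - s\<bar> < d \<Longrightarrow> L2_norm (\<lambda>x. K (x, t) - K (x, s)) < e / 2"
    using LIM_D[OF K0_kernel_column_continuous[OF K, of s], of "e / 2"] e by auto
  obtain N where N: "1 / real (Suc N) < d" using d(1) nat_approx_posE by blast
  have "L2_norm (\<lambda>x. A (approx_delta n s) x - K (x, s)) \<le> e / 2" if n: "n \<ge> N" for n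
  proof (rule induces_approx_delta_norm_le[OF K A])
    fix t assume t: "t \<in> window n s"
    have "1 / real (Suc n) \<le> 1 / real (Suc N)" using n by (simp add: frac_le)
    then have "\<bar>t - s\<bar> < d" using N t by (auto simp: mem_window)
    then show "L2_norm (\<lambda>x. K (x, t) - K (x, s)) \<le> e / 2"
      using d(2)[of t] e by (cases "t = s") (auto simp: L2_norm_def less_imp_le)
  qed
  then show "\<exists>N. \<forall>n\<ge>N. dist (L2_norm (\<lambda>x. A (approx_delta n s) x - K (x, s))) 0 < e"
    using e by (intro exI[of _ N]) (force simp: dist_real_def)
qed

lemma induces_approx_delta_lincomb_tendsto:
  assumes K: "K0_kernel K" and A: "induces K A"
  shows "(\<lambda>n. L2_norm (A (\<lambda>x. a * approx_delta n s x + b * approx_delta n t x)))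
           \<longlonglongrightarrow> L2_norm (\<lambda>x. a * K (x, s) + b * K (x, t))"
proof -
  have op: "L2_bounded_op A" using A by (rule induces_bounded_op)
  have in_L2: "A (approx_delta n s) \<in> L2" for n s by (intro L2_bounded_op_closed[OF op] approx_delta_in_L2)
  let ?F = "\<lambda>n x. a * A (approx_delta n s) x + b * A (approx_delta n t) x"
  have "L2_norm (A (\<lambda>x. a * approx_delta n s x + b * approx_delta n t x)) = L2_norm (?F n)" for n
    by (intro L2_norm_cong L2_bounded_op_closed[OF op] L2_lincomb approx_delta_in_L2
        L2_bounded_op_lincomb[OF op] in_L2)
  moreover have "(\<lambda>n. L2_norm (?F n)) \<longlonglongrightarrow> L2_norm (\<lambda>x. a * K (x, s) + b * K (x, t))"
  proof (rule L2_norm_tendsto)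
    have le: "L2_norm (\<lambda>x. ?F n x - (a * K (x, s) + b * K (x, t)))
        \<le> cmod a * L2_norm (\<lambda>x. A (approx_delta n s) x - K (x, s))
          + cmod b * L2_norm (\<lambda>x. A (approx_delta n t) x - K (x, t))" for n
      using L2_norm_lincomb_le[OF L2_diff[OF in_L2 K0_kernel_column[OF K]]
          L2_diff[OF in_L2 K0_kernel_column[OF K]], of a n s s b n t t]
      by (simp add: algebra_simps)
    have "(\<lambda>n. cmod a * L2_norm (\<lambda>x. A (approx_delta n s) x - K (x, s))
             + cmod b * L2_norm (\<lambda>x. A (approx_delta n t) x - K (x, t))) \<longlonglongrightarrow> 0"
      by (intro tendsto_add_zero tendsto_mult_right_zero induces_approx_delta_tendsto[OF K A])
    then show "(\<lambda>n. L2_norm (\<lambda>x. ?F n x - (a * K (x, s) + b * K (x, t)))) \<longlonglongrightarrow> 0"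
      by (rule Lim_null_comparison[rotated]) (use le in auto)
  qed (intro L2_lincomb in_L2 K0_kernel_column[OF K])+
  ultimately show ?thesis by simp
qed

text \<open>
  A norm inequality between two operators, tested on combinations of approximate point masses, is
  a norm inequality between the same combinations of the columns of their kernels.
\<close>

lemma induces_column_norm_le:
  assumes K: "K0_kernel K" "induces K A" and H: "K0_kernel H" "induces H B"
    and le: "\<And>h. h \<in> L2 \<Longrightarrow> d * L2_norm (A h) \<le> L2_norm (B h)"
  shows "d * L2_norm (\<lambda>x. a * K (x, s) + b * K (x, t)) \<le> L2_norm (\<lambda>x. a * H (x, s) + b * H (x, t))"
  by (rule LIMSEQ_le[OF tendsto_mult_left[OF induces_approx_delta_lincomb_tendsto[OF K]]
        induces_approx_delta_lincomb_tendsto[OF H]])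
    (auto intro!: le L2_lincomb approx_delta_in_L2)

text \<open>
  Formally \<open>K(s, t) = \<langle>Q \<delta>\<^sub>t, \<delta>\<^sub>s\<rangle> = \<langle>Q \<delta>\<^sub>t, Q \<delta>\<^sub>s\<rangle>\<close>. The point masses are approximated
  one after the other: the limit at \<open>t\<close> comes first, so that at \<open>s\<close> only the continuous function
  \<open>K(\<cdot>, t)\<close> is averaged.
\<close>

lemma projection_kernel_eq_inner:
  assumes K: "K0_kernel K" "induces K Q" and Q: "L2_orthogonal_projection Q"
  shows "K (s, t) = L2_inner (\<lambda>x. K (x, t)) (\<lambda>x. K (x, s))"
proof -
  have op: "L2_bounded_op Q" using K(2) by (rule induces_bounded_op)
  have col: "(\<lambda>x. K (x, r)) \<in> L2" for r using K(1) by (rule K0_kernel_column)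
  have in_L2: "Q (approx_delta n r) \<in> L2" for n r by (intro L2_bounded_op_closed[OF op] approx_delta_in_L2)
  have "L2_inner (Q f) g = L2_inner (Q f) (Q g)" if "f \<in> L2" "g \<in> L2" for f g
  proof -
    have "L2_inner (Q f) g = L2_inner (Q (Q f)) g"
      using Q that by (intro L2_inner_cong L2_bounded_op_closed[OF op])
        (auto simp: L2_orthogonal_projection_def L2_bounded_op_def elim: eventually_mono)
    also have "\<dots> = L2_inner (Q f) (Q g)"
      using Q that L2_bounded_op_closed[OF op] by (simp add: L2_orthogonal_projection_def)
    finally show ?thesis .
  qed
  then have "L2_inner (\<lambda>x. K (x, t)) (approx_delta m s) = L2_inner (\<lambda>x. K (x, t)) (Q (approx_delta m s))" for m
    using LIMSEQ_unique[OF L2_inner_tendsto[OF in_L2 col approx_delta_in_L2 induces_approx_delta_tendsto[OF K]]]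
      L2_inner_tendsto[OF in_L2 col in_L2 induces_approx_delta_tendsto[OF K], of t m s] approx_delta_in_L2
    by simp
  moreover have "(\<lambda>m. L2_inner (\<lambda>x. K (x, t)) (Q (approx_delta m s))) \<longlonglongrightarrow> L2_inner (\<lambda>x. K (x, t)) (\<lambda>x. K (x, s))"
    using tendsto_cnj[OF L2_inner_tendsto[OF in_L2 col col induces_approx_delta_tendsto[OF K], of s t]]
    by (simp flip: L2_inner_commute)
  moreover have "(\<lambda>m. L2_inner (\<lambda>x. K (x, t)) (approx_delta m s)) \<longlonglongrightarrow> K (s, t)"
  proof -
    have "continuous_on UNIV (\<lambda>x. K (x, t))"
      by (intro continuous_on_compose2[OF K0_kernel_continuous[OF K(1)]] continuous_intros) auto
    moreover have "cnj (approx_delta m s x) = approx_delta m s x" for m x by (simp add: approx_delta_def indicator_def)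
    ultimately show ?thesis
      unfolding L2_inner_def using approx_delta_average_tendsto by simp
  qed
  ultimately show ?thesis using LIMSEQ_unique by simp
qed

section \<open>Uniform continuity of the columns of a kernel\<close>

lemma K0_kernel_column_norm:
  assumes K: "K0_kernel K"
  shows "continuous_on UNIV (\<lambda>s. L2_norm (\<lambda>x. K (x, s)))"
    and "((\<lambda>s. L2_norm (\<lambda>x. K (x, s))) \<longlongrightarrow> 0) at_infinity"
proof -
  note col = K0_kernel_column[OF K]
  have "(\<lambda>s. L2_norm (\<lambda>x. K (x, s))) \<midarrow>s\<rightarrow> L2_norm (\<lambda>x. K (x, s))" for s
  proof (rule LIM_zero_cancel, rule Lim_null_comparison[OF _ K0_kernel_column_continuous[OF K]],
      intro always_eventually allI)
    fix r
    show "norm (L2_norm (\<lambda>x. K (x, r)) - L2_norm (\<lambda>x. K (x, s))) \<le> L2_norm (\<lambda>x. K (x, r) - K (x, s))"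
      using L2_norm_triangle_diff[OF col col, of r s] L2_norm_triangle_diff[OF col col, of s r]
        L2_norm_minus_commute[of "\<lambda>x. K (x, r)" "\<lambda>x. K (x, s)"]
      by simp
  qed
  then show "continuous_on UNIV (\<lambda>s. L2_norm (\<lambda>x. K (x, s)))"
    by (simp add: continuous_on_def)
  show "((\<lambda>s. L2_norm (\<lambda>x. K (x, s))) \<longlongrightarrow> 0) at_infinity"
    using K by (simp add: K0_kernel_def C0_L2_def)
qed

text \<open>
  Heine's theorem for the Hilbert space valued map \<open>s \<mapsto> K(\<cdot>, s)\<close>. It is applied to the distance
  \<open>\<phi>(s, t)\<close> of two columns, a continuous function on the plane that vanishes on the diagonal; far from the
  origin both columns are small.
\<close>

lemma K0_kernel_column_uniform:
  assumes K: "K0_kernel K" and e: "0 < e"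
  obtains d where "0 < d"
    "\<And>s t. \<bar>s - t\<bar> < d \<Longrightarrow> L2_norm (\<lambda>x. K (x, s) - K (x, t)) \<le> e"
proof -
  note col = K0_kernel_column[OF K]
  define \<phi> where "\<phi> = (\<lambda>p. L2_norm (\<lambda>x. K (x, fst p) - K (x, snd p)))"
  have tri: "\<phi> (s, t) \<le> \<phi> (s, s') + \<phi> (s', t') + \<phi> (t', t)" for s t s' t'
  proof -
    have "\<phi> (a, c) \<le> \<phi> (a, b) + \<phi> (b, c)" for a b c
      unfolding \<phi>_def fst_conv snd_conv by (intro L2_norm_diff_triangle col)
    from this[of s t s'] this[of s' t t'] show ?thesis by linarith
  qed
  have sym: "\<phi> (s, t) = \<phi> (t, s)" for s t
    unfolding \<phi>_def fst_conv snd_conv by (rule L2_norm_minus_commute)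
  have \<phi>_lim: "((\<lambda>r. \<phi> (r, s)) \<longlongrightarrow> 0) (nhds s)" for s
  proof -
    have "\<phi> (s, s) = 0" by (simp add: \<phi>_def L2_norm_def)
    then show ?thesis
      using K0_kernel_column_continuous[OF K, of s] tendsto_at_iff_tendsto_nhds[of "\<lambda>r. \<phi> (r, s)" s]
      by (simp add: \<phi>_def)
  qed
  have "continuous_on UNIV \<phi>"
    unfolding continuous_on_def
  proof (intro ballI)
    fix p :: "real \<times> real"
    have lim: "((\<lambda>q. \<phi> (fst q, fst p)) \<longlongrightarrow> 0) (at p)" "((\<lambda>q. \<phi> (snd q, snd p)) \<longlongrightarrow> 0) (at p)"
      by (auto intro!: filterlim_compose[OF \<phi>_lim] tendsto_eq_intros)
    show "(\<phi> \<longlongrightarrow> \<phi> p) (at p within UNIV)"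
    proof (rule LIM_zero_cancel, rule Lim_null_comparison[OF _ tendsto_add_zero[OF lim]],
        intro always_eventually allI)
      fix q
      show "norm (\<phi> q - \<phi> p) \<le> \<phi> (fst q, fst p) + \<phi> (snd q, snd p)"
        using tri[of "fst q" "snd q" "fst p" "snd p"] tri[of "fst p" "snd p" "fst q" "snd q"]
          sym[of "fst q" "fst p"] sym[of "snd q" "snd p"]
        by simp
    qed
  qed
  obtain R where R: "\<And>s. R \<le> norm s \<Longrightarrow> dist (L2_norm (\<lambda>x. K (x, s))) 0 < e / 2"
    using tendstoD[OF K0_kernel_column_norm(2)[OF K], of "e / 2"] e
    unfolding eventually_at_infinity by auto
  let ?J = "{- \<bar>R\<bar> - 1 .. \<bar>R\<bar> + 1}"
  have "uniformly_continuous_on (?J \<times> ?J) \<phi>"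
    using \<open>continuous_on UNIV \<phi>\<close> by (intro compact_uniformly_continuous compact_Times)
      (auto intro: continuous_on_subset)
  then obtain d where d: "d > 0"
    "\<And>p q. p \<in> ?J \<times> ?J \<Longrightarrow> q \<in> ?J \<times> ?J \<Longrightarrow> dist q p < d \<Longrightarrow> dist (\<phi> q) (\<phi> p) < e"
    unfolding uniformly_continuous_on_def using e by metis
  have "L2_norm (\<lambda>x. K (x, s) - K (x, t)) \<le> e" if st: "\<bar>s - t\<bar> < min d 1" for s t
  proof (cases "\<bar>R\<bar> \<le> \<bar>s\<bar> \<and> \<bar>R\<bar> \<le> \<bar>t\<bar>")
    case True
    then have "R \<le> norm s" "R \<le> norm t" by auto
    from this[THEN R] show ?thesis
      using L2_norm_diff_le[OF col col, of s t] by simp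
  next
    case False
    then have J: "s \<in> ?J" "t \<in> ?J" using st by auto
    have "dist (s, t) (t, t) < d" using st by (simp add: dist_Pair_Pair dist_real_def)
    with J have "dist (\<phi> (s, t)) (\<phi> (t, t)) < e" by (intro d(2)) auto
    moreover have "\<phi> (t, t) = 0" by (simp add: \<phi>_def L2_norm_def)
    ultimately show ?thesis by (simp add: \<phi>_def dist_norm)
  qed
  then show thesis using d(1) by (intro that[of "min d 1"]) auto
qed

section \<open>Truncated kernels\<close>

text \<open>
  The truncated kernel vanishes outside the open interval, in particular at its endpoints, and agrees
  with \<open>T\<close> inside. Continuity forces \<open>T\<close> itself to vanish at the endpoints.
\<close>

lemma subkernel_boundary_row:
  assumes "continuous_on UNIV T" "continuous_on UNIV (subkernel r T)" "0 < r"
  shows "T (r, t) = 0" "T (- r, t) = 0"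
proof -
  have cont: "((\<lambda>y. K (y, t)) \<longlongrightarrow> K (a, t)) (at a within S)"
    if "continuous_on UNIV K" for K :: "real \<times> real \<Rightarrow> complex" and a S
  proof -
    have "continuous_on UNIV (\<lambda>y. K (y, t))"
      by (intro continuous_on_compose2[OF that] continuous_intros) auto
    then show ?thesis
      by (auto simp: continuous_on_def intro: tendsto_within_subset)
  qed
  have left: "\<forall>\<^sub>F y in at_left r. subkernel r T (y, t) = T (y, t)"
    using assms(3) by (intro eventually_at_leftI[of "- r"]) (auto simp: subkernel_def)
  have "T (r, t) = subkernel r T (r, t)"
    by (rule tendsto_unique[OF trivial_limit_at_left_real cont[OF assms(1)]
          Lim_transform_eventually[OF cont[OF assms(2)] left]])
  then show "T (r, t) = 0" by (simp add: subkernel_def)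
  have right: "\<forall>\<^sub>F y in at_right (- r). subkernel r T (y, t) = T (y, t)"
    using assms(3) by (intro eventually_at_rightI[of _ r]) (auto simp: subkernel_def)
  have "T (- r, t) = subkernel r T (- r, t)"
    by (rule tendsto_unique[OF trivial_limit_at_right_real cont[OF assms(1)]
          Lim_transform_eventually[OF cont[OF assms(2)] right]])
  then show "T (- r, t) = 0" by (simp add: subkernel_def)
qed

text \<open>
  The column of the truncation at \<open>s\<close> is a column of \<open>T\<close> at the point nearest to \<open>s\<close> in
  \<open>[-r, r]\<close>, cut off. Beyond the interval both sides vanish thanks to the boundary values; the gain is
  that the dependence on \<open>s\<close> no longer involves a discontinuous factor.
\<close>

lemma subkernel_tilde_column:
  assumes "\<And>x. T (x, r) = 0" "\<And>x. T (x, - r) = 0" "0 < r"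
  shows "subkernel_tilde r T (x, s) = indicator {-r<..<r} x * T (x, max (- r) (min r s))"
  using assms by (auto simp: subkernel_tilde_def indicator_def max_def min_def)

lemma subkernel_tilde_induces:
  assumes T: "induces T A" and op: "L2_bounded_op (\<lambda>f. cutoff r (A (cutoff r f)))"
  shows "induces (subkernel_tilde r T) (\<lambda>f. cutoff r (A (cutoff r f)))"
  unfolding induces_def
proof (intro conjI ballI op)
  fix f assume f: "f \<in> L2"
  have "cutoff r f \<in> L2"
    unfolding cutoff_def
    by (rule L2_bounded_multiple(1)[OF f borel_measurable_indicator]) (auto simp: indicator_def)
  then have "AE s in lebesgue. A (cutoff r f) s = (LINT t|lebesgue. T (s, t) * cutoff r f t)"
    using T by (simp add: induces_def)
  then show "AE s in lebesgue. cutoff r (A (cutoff r f)) s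
      = (LINT t|lebesgue. subkernel_tilde r T (s, t) * f t)"
  proof eventually_elim
    case (elim s)
    have "cutoff r (A (cutoff r f)) s
        = indicator {-r<..<r} s * (LINT t|lebesgue. T (s, t) * cutoff r f t)"
      using elim by (simp add: cutoff_def)
    also have "\<dots> = (LINT t|lebesgue. indicator {-r<..<r} s * (T (s, t) * cutoff r f t))"
      by (rule Bochner_Integration.integral_mult_right_zero[symmetric])
    also have "\<dots> = (LINT t|lebesgue. subkernel_tilde r T (s, t) * f t)"
      by (simp add: subkernel_tilde_def cutoff_def mult_ac)
    finally show ?case .
  qed
qed

section \<open>Compactness in the space of continuous functions vanishing at infinity\<close>

lemma C0_real_bounded:
  fixes f :: "real \<Rightarrow> real"
  assumes "continuous_on UNIV f" "(f \<longlongrightarrow> 0) at_infinity"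
  obtains M where "M \<ge> 0" "\<And>x. \<bar>f x\<bar> \<le> M"
proof -
  obtain R where R: "\<And>x. R \<le> norm x \<Longrightarrow> dist (f x) 0 < 1"
    using tendstoD[OF assms(2), of 1] unfolding eventually_at_infinity by auto
  have "compact (f ` cball 0 R)"
    using assms(1) by (intro compact_continuous_image) (auto intro: continuous_on_subset)
  then obtain B where B: "\<And>x. x \<in> cball 0 R \<Longrightarrow> norm (f x) \<le> B"
    by (metis compact_imp_bounded bounded_iff imageI)
  have "\<bar>f x\<bar> \<le> max 1 B" for x
    using R[of x] B[of x] by (cases "R \<le> norm x") (auto simp: dist_norm)
  then show thesis by (intro that[of "max 1 B"]) auto
qed

text \<open>
  The Arzela-Ascoli argument on a noncompact space. A diagonal subsequence converges on a countable
  dense set; equicontinuity makes it uniformly Cauchy on a large ball, and tightness controls the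
  complement of the ball.
\<close>

lemma C0_converges_subsequence:
  fixes F :: "nat \<Rightarrow> 'a::euclidean_space \<Rightarrow> 'b::{banach, heine_borel}"
  assumes bounded: "\<And>n x. norm (F n x) \<le> M"
    and equicontinuous:
      "\<And>e. 0 < e \<Longrightarrow> \<exists>d>0. \<forall>n x y. dist x y < d \<longrightarrow> norm (F n x - F n y) < e"
    and tight: "\<And>e. 0 < e \<Longrightarrow> \<exists>R. \<forall>n x. R \<le> norm x \<longrightarrow> norm (F n x) < e"
  shows "\<exists>r. strict_mono r \<and> C0_converges (\<lambda>k. F (r k))"
proof -
  obtain D :: "'a set" where D: "countable D" "UNIV \<subseteq> closure D"
    using separable[of "UNIV :: 'a set"] by metis
  obtain r where r: "strict_mono r" "\<And>x. x \<in> D \<Longrightarrow> \<exists>l. (\<lambda>n. F (r n) x) \<longlonglongrightarrow> l"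
    using function_convergent_subsequence[OF D(1), of F M] bounded by metis
  have "uniformly_Cauchy_on UNIV (\<lambda>n. F (r n))"
    unfolding uniformly_Cauchy_on_def
  proof (intro allI impI)
    fix e :: real assume e: "e > 0"
    obtain d where d: "d > 0" "\<And>n x y. dist x y < d \<Longrightarrow> norm (F n x - F n y) < e / 3"
      using equicontinuous[of "e / 3"] e by auto
    obtain R where R: "\<And>n x. R \<le> norm x \<Longrightarrow> norm (F n x) < e / 2"
      using tight[of "e / 2"] e by auto
    have "cball (0::'a) R \<subseteq> (\<Union>c\<in>D. ball c d)"
      using D(2) d(1) by (fastforce simp: closure_approachable)
    then obtain C where C: "C \<subseteq> D" "finite C" "cball (0::'a) R \<subseteq> (\<Union>c\<in>C. ball c d)"
      using compactE_image[OF compact_cball, of D "\<lambda>c. ball c d" 0 R] by auto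
    have "\<forall>c\<in>C. \<exists>N. \<forall>m\<ge>N. \<forall>n\<ge>N. norm (F (r m) c - F (r n) c) < e / 3"
    proof
      fix c assume "c \<in> C"
      then have "Cauchy (\<lambda>n. F (r n) c)"
        using r(2) C(1) convergent_eq_Cauchy by blast
      then show "\<exists>N. \<forall>m\<ge>N. \<forall>n\<ge>N. norm (F (r m) c - F (r n) c) < e / 3"
        using e unfolding Cauchy_def dist_norm by (meson divide_pos_pos zero_less_numeral)
    qed
    then obtain N where N: "\<And>c m n. c \<in> C \<Longrightarrow> m \<ge> N c \<Longrightarrow> n \<ge> N c \<Longrightarrow> norm (F (r m) c - F (r n) c) < e / 3"
      by metis
    show "\<exists>M. \<forall>x\<in>UNIV. \<forall>m\<ge>M. \<forall>n\<ge>M. dist (F (r m) x) (F (r n) x) < e"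
    proof (intro exI ballI allI impI)
      fix x m n assume mn: "m \<ge> (\<Sum>c\<in>C. N c)" "n \<ge> (\<Sum>c\<in>C. N c)"
      show "dist (F (r m) x) (F (r n) x) < e"
      proof (cases "R \<le> norm x")
        case True
        then show ?thesis
          using R[of x "r m"] R[of x "r n"] norm_triangle_ineq4[of "F (r m) x" "F (r n) x"]
          by (simp add: dist_norm)
      next
        case False
        then obtain c where c: "c \<in> C" "dist c x < d"
          using C(3) by (force simp: dist_norm)
        have "N c \<le> (\<Sum>c\<in>C. N c)" using c(1) C(2) by (simp add: member_le_sum)
        then have "dist (F (r m) c) (F (r n) c) < e / 3"
          using N[OF c(1)] mn by (simp add: dist_norm)
        moreover have "dist (F (r m) x) (F (r m) c) < e / 3" "dist (F (r n) c) (F (r n) x) < e / 3"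
          using d(2) c(2) by (simp_all add: dist_norm norm_minus_commute)
        ultimately show ?thesis
          using dist_triangle_third by blast
      qed
    qed
  qed
  then obtain g where g: "uniform_limit UNIV (\<lambda>n. F (r n)) g sequentially"
    by (metis uniformly_convergent_on_def Cauchy_uniformly_convergent)
  have close: "\<exists>N. \<forall>n\<ge>N. \<forall>x. norm (F (r n) x - g x) < e" if "e > 0" for e
    using uniform_limitD[OF g that] by (auto simp: eventually_sequentially dist_norm)
  have "continuous_on UNIV g"
  proof (rule uniform_limit_theorem[OF _ g])
    show "\<forall>\<^sub>F n in sequentially. continuous_on UNIV (F (r n))"
      using equicontinuous unfolding continuous_on_iff dist_norm
      by (intro always_eventually allI ballI impI) (metis dist_commute dist_norm)
  qed simp
  moreover have "(g \<longlongrightarrow> 0) at_infinity"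
    unfolding tendsto_iff eventually_at_infinity
  proof (intro allI impI)
    fix e :: real assume e: "e > 0"
    obtain R where R: "\<And>n x. R \<le> norm x \<Longrightarrow> norm (F n x) < e / 2"
      using tight[of "e / 2"] e by auto
    obtain N where N: "\<And>x. norm (F (r N) x - g x) < e / 2"
      using close[of "e / 2"] e by auto
    have "norm (g x) < e" if "R \<le> norm x" for x
      using R[OF that, of "r N"] N[of x] norm_triangle_ineq4[of "F (r N) x" "F (r N) x - g x"] by simp
    then show "\<exists>b. \<forall>x. b \<le> norm x \<longrightarrow> dist (g x) 0 < e" by auto
  qed
  moreover have "(\<lambda>k. C0_norm (\<lambda>x. F (r k) x - g x)) \<longlonglongrightarrow> 0"
    unfolding lim_sequentially
  proof (intro allI impI)
    fix e :: real assume e: "e > 0"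
    obtain N where N: "\<And>n x. n \<ge> N \<Longrightarrow> norm (F (r n) x - g x) < e / 2"
      using close[of "e / 2"] e by auto
    have "C0_norm (\<lambda>x. F (r n) x - g x) \<le> e / 2" "0 \<le> C0_norm (\<lambda>x. F (r n) x - g x)" if "n \<ge> N" for n
    proof -
      show "C0_norm (\<lambda>x. F (r n) x - g x) \<le> e / 2"
        unfolding C0_norm_def using N[OF that] by (intro cSUP_least) (auto intro: less_imp_le)
      have "norm (F (r n) 0 - g 0) \<le> C0_norm (\<lambda>x. F (r n) x - g x)"
        unfolding C0_norm_def using N[OF that]
        by (intro cSUP_upper bdd_aboveI[of _ "e / 2"]) (auto intro: less_imp_le)
      then show "0 \<le> C0_norm (\<lambda>x. F (r n) x - g x)"
        by (rule order_trans[OF norm_ge_zero])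
    qed
    then show "\<exists>N. \<forall>n\<ge>N. dist (C0_norm (\<lambda>x. F (r n) x - g x)) 0 < e"
      using e by (intro exI[of _ N]) (force simp: dist_real_def)
  qed
  ultimately show ?thesis
    using r(1) unfolding C0_converges_def C0_def by blast
qed

section \<open>Relative compactness of the spectral functions\<close>

theorem theorem9:
  fixes T :: "real \<times> real \<Rightarrow> complex"
    and Top :: "(real \<Rightarrow> complex) \<Rightarrow> (real \<Rightarrow> complex)"
    and \<tau> :: "nat \<Rightarrow> real"
    and \<omega> :: "real set"
    and E :: "nat \<Rightarrow> real set \<Rightarrow> (real \<Rightarrow> complex) \<Rightarrow> (real \<Rightarrow> complex)"
    and E\<omega> :: "nat \<Rightarrow> real \<times> real \<Rightarrow> complex"
  assumes T_kernel: "K0_kernel T"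
    and T_induces: "induces T Top"
    and \<tau>_pos: "\<And>n. 0 < \<tau> n"
    and \<tau>_strict_mono: "strict_mono \<tau>"
    and \<tau>_unbounded: "filterlim \<tau> at_top sequentially"
    and sub_kernel: "\<And>n. K0_kernel (subkernel (\<tau> n) T)"
    and sub_tilde_kernel: "\<And>n. K0_kernel (subkernel_tilde (\<tau> n) T)"
    and sub_nuclear: "\<And>n. L2_nuclear (\<lambda>f. cutoff (\<tau> n) (Top f))"
    and sub_tilde_nuclear: "\<And>n. L2_nuclear (\<lambda>f. cutoff (\<tau> n) (Top (cutoff (\<tau> n) f)))"
    and T_hermitian: "hermitian_kernel T"
    and \<omega>: "\<omega> \<in> Omega0"
    and E_resolution:
      "\<And>n. resolution_of_identity (\<lambda>f. cutoff (\<tau> n) (Top (cutoff (\<tau> n) f))) (E n)"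
    and E\<omega>_kernel: "\<And>n. K0_kernel (E\<omega> n)"
    and E\<omega>_induces: "\<And>n. induces (E\<omega> n) (E n \<omega>)"
  shows "C0_relatively_compact (range E\<omega>) \<and>
         (\<forall>m :: nat \<Rightarrow> nat. \<exists>r :: nat \<Rightarrow> nat. strict_mono r \<and>
            C0_converges (\<lambda>k. E\<omega> (m (r k))))"
proof -
  have \<omega>_borel: "\<omega> \<in> sets borel" using \<omega> by (simp add: Omega0_def)
  obtain d where d: "d > 0" "\<And>x. x \<in> \<omega> \<Longrightarrow> d \<le> \<bar>x\<bar>"
    using \<omega> unfolding Omega0_def closure_approachable by (fastforce simp: dist_norm not_less)
  define S where "S = (\<lambda>n f. cutoff (\<tau> n) (Top (cutoff (\<tau> n) f)))"
  have S_op: "L2_bounded_op (S n)" for n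
    using sub_tilde_nuclear[of n] by (simp add: S_def L2_nuclear_def)
  have S_induces: "induces (subkernel_tilde (\<tau> n) T) (S n)" for n
    using subkernel_tilde_induces[OF T_induces] S_op[of n] by (simp add: S_def)
  have gap: "d * L2_norm (E n \<omega> h) \<le> L2_norm (S n h)" if "h \<in> L2" for n h
    using resolution_norm_le[OF E_resolution[of n] _ \<omega>_borel d(2,1) that] S_op[of n]
    by (simp add: S_def)
  note T_col = K0_kernel_column[OF T_kernel]
  note E_col = K0_kernel_column[OF E\<omega>_kernel]
  define N where "N = (\<lambda>s. L2_norm (\<lambda>x. T (x, s)))"

  define clamp where "clamp = (\<lambda>r s. max (- r) (min r s) :: real)"
  have tilde: "subkernel_tilde (\<tau> n) T (x, s) = indicator {- \<tau> n<..<\<tau> n} x * T (x, clamp (\<tau> n) s)"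
    for n x s
  proof -
    note bd = subkernel_boundary_row[OF K0_kernel_continuous[OF T_kernel]
        K0_kernel_continuous[OF sub_kernel] \<tau>_pos, of n]
    have "T (x, \<tau> n) = 0" "T (x, - \<tau> n) = 0" for x
      using T_hermitian bd[of x] unfolding hermitian_kernel_def by (metis complex_cnj_zero)+
    then show ?thesis unfolding clamp_def by (intro subkernel_tilde_column \<tau>_pos)
  qed
  have ind: "indicator {- a<..<a} \<in> borel_measurable lebesgue" "cmod (indicator {- a<..<a} s) \<le> 1"
    for a s :: real
    by (rule borel_measurable_indicator, simp, simp add: indicator_def)
  have col_norm: "d * L2_norm (\<lambda>x. E\<omega> n (x, s)) \<le> N s" for n s
  proof -
    have "d * L2_norm (\<lambda>x. E\<omega> n (x, s)) \<le> L2_norm (\<lambda>x. subkernel_tilde (\<tau> n) T (x, s))"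
      using induces_column_norm_le[OF E\<omega>_kernel[of n] E\<omega>_induces sub_tilde_kernel S_induces gap,
          where a = 1 and b = 0 and s = s]
      by simp
    also have "(\<lambda>x. subkernel_tilde (\<tau> n) T (x, s))
        = (\<lambda>x. (indicator {- \<tau> n<..<\<tau> n} x * indicator {- \<tau> n<..<\<tau> n} s) * T (x, s))"
      by (auto simp: subkernel_tilde_def)
    also have "L2_norm \<dots> \<le> N s"
      unfolding N_def
      by (intro L2_bounded_multiple(2) T_col borel_measurable_times ind(1) borel_measurable_const)
        (auto simp: indicator_def)
    finally show ?thesis .
  qed
  have col_diff: "d * L2_norm (\<lambda>x. E\<omega> n (x, s) - E\<omega> n (x, t))
      \<le> L2_norm (\<lambda>x. T (x, clamp (\<tau> n) s) - T (x, clamp (\<tau> n) t))" for n s t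
  proof -
    have "d * L2_norm (\<lambda>x. E\<omega> n (x, s) - E\<omega> n (x, t))
        \<le> L2_norm (\<lambda>x. subkernel_tilde (\<tau> n) T (x, s) - subkernel_tilde (\<tau> n) T (x, t))"
      using induces_column_norm_le[OF E\<omega>_kernel[of n] E\<omega>_induces sub_tilde_kernel S_induces gap,
          where a = 1 and b = "-1" and s = s and t = t]
      by simp
    also have "\<dots> = L2_norm (\<lambda>x. indicator {- \<tau> n<..<\<tau> n} x
        * (T (x, clamp (\<tau> n) s) - T (x, clamp (\<tau> n) t)))"
      by (simp add: tilde right_diff_distrib)
    also have "\<dots> \<le> L2_norm (\<lambda>x. T (x, clamp (\<tau> n) s) - T (x, clamp (\<tau> n) t))"
      by (intro L2_bounded_multiple(2) L2_diff T_col ind)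
    finally show ?thesis .
  qed
  have kernel_eq: "E\<omega> n (s, t) = L2_inner (\<lambda>x. E\<omega> n (x, t)) (\<lambda>x. E\<omega> n (x, s))" for n s t
    by (rule projection_kernel_eq_inner[OF E\<omega>_kernel E\<omega>_induces
          resolution_projection(1)[OF E_resolution \<omega>_borel]])

  obtain M where M: "M \<ge> 0" "\<And>s. N s \<le> M"
    using C0_real_bounded[OF K0_kernel_column_norm[OF T_kernel]] unfolding N_def
    by (metis abs_le_D1)
  have N_nonneg: "0 \<le> N s" for s by (simp add: N_def)
  have bound: "norm (E\<omega> n (s, t)) \<le> N s / d * (N t / d)" for n s t
  proof -
    have "norm (E\<omega> n (s, t)) \<le> L2_norm (\<lambda>x. E\<omega> n (x, t)) * L2_norm (\<lambda>x. E\<omega> n (x, s))"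
      unfolding kernel_eq[of n s t] by (rule L2_Cauchy_Schwarz[OF E_col E_col])
    also have "\<dots> \<le> N t / d * (N s / d)"
      using col_norm[of n] d(1) N_nonneg
      by (intro mult_mono) (auto simp: pos_le_divide_eq mult.commute)
    finally show ?thesis by (simp add: mult.commute)
  qed
  have bounded: "norm (E\<omega> n p) \<le> M / d * (M / d)" for n p
  proof -
    have "norm (E\<omega> n p) \<le> N (fst p) / d * (N (snd p) / d)" using bound[of n "fst p" "snd p"] by simp
    also have "\<dots> \<le> M / d * (M / d)"
      using M d(1) N_nonneg by (intro mult_mono divide_right_mono) auto
    finally show ?thesis .
  qed
  have equicontinuous: "\<exists>\<delta>>0. \<forall>n p q. dist p q < \<delta> \<longrightarrow> norm (E\<omega> n p - E\<omega> n q) < e"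
    if e: "e > 0" for e
  proof -
    \<comment> \<open>Chosen so that \<open>2 (\<eta> / d) (M / d) < e\<close>; adding \<open>1\<close> to \<open>M\<close> also covers \<open>M = 0\<close>.\<close>
    define \<eta> where "\<eta> = e * d\<^sup>2 / (2 * (M + 1))"
    have \<eta>: "\<eta> > 0" using e d(1) M(1) by (simp add: \<eta>_def)
    obtain \<delta> where \<delta>: "\<delta> > 0" "\<And>s t. \<bar>s - t\<bar> < \<delta> \<Longrightarrow> L2_norm (\<lambda>x. T (x, s) - T (x, t)) \<le> \<eta>"
      using K0_kernel_column_uniform[OF T_kernel \<eta>] by blast
    have diff: "L2_norm (\<lambda>x. E\<omega> n (x, s) - E\<omega> n (x, t)) \<le> \<eta> / d" if "\<bar>s - t\<bar> < \<delta>" for n s t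
    proof -
      have "\<bar>clamp (\<tau> n) s - clamp (\<tau> n) t\<bar> \<le> \<bar>s - t\<bar>"
        by (auto simp: clamp_def max_def min_def)
      then have "d * L2_norm (\<lambda>x. E\<omega> n (x, s) - E\<omega> n (x, t)) \<le> \<eta>"
        using col_diff[of n s t] \<delta>(2)[of "clamp (\<tau> n) s" "clamp (\<tau> n) t"] that by linarith
      then show ?thesis using d(1) by (simp add: pos_le_divide_eq mult.commute)
    qed
    have norm_col: "L2_norm (\<lambda>x. E\<omega> n (x, s)) \<le> M / d" for n s
      using col_norm[of n s] M(2)[of s] d(1) by (simp add: pos_le_divide_eq mult.commute)
    have close: "norm (E\<omega> n (s, t) - E\<omega> n (s', t')) < e" if st: "\<bar>s - s'\<bar> < \<delta>" "\<bar>t - t'\<bar> < \<delta>" for n s t s' t'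
    proof -
      let ?c = "\<lambda>s x. E\<omega> n (x, s)"
      have "E\<omega> n (s, t) - E\<omega> n (s', t')
          = L2_inner (\<lambda>x. ?c t x - ?c t' x) (?c s) + L2_inner (?c t') (\<lambda>x. ?c s x - ?c s' x)"
        unfolding kernel_eq[of n s t] kernel_eq[of n s' t']
          L2_inner_diff_left[OF E_col E_col E_col] L2_inner_diff_right[OF E_col E_col E_col]
        by simp
      also have "norm \<dots> \<le> \<eta> / d * (M / d) + M / d * (\<eta> / d)"
        using \<eta> d(1) M(1)
        by (intro norm_triangle_mono order_trans[OF L2_Cauchy_Schwarz] mult_mono L2_diff E_col
            diff norm_col st) auto
      also have "\<dots> = 2 * (\<eta> / d\<^sup>2) * M" by (simp add: power2_eq_square)
      also have "\<eta> / d\<^sup>2 = e / (2 * (M + 1))" using d(1) by (simp add: \<eta>_def)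
      also have "2 * (e / (2 * (M + 1))) * M = e * (M / (M + 1))"
        using M(1) by (simp add: divide_simps)
      also have "\<dots> < e" using e M(1) by (simp add: field_simps)
      finally show ?thesis .
    qed
    have "norm (E\<omega> n p - E\<omega> n q) < e" if "dist p q < \<delta>" for n p q
    proof -
      have "\<bar>fst p - fst q\<bar> < \<delta>" "\<bar>snd p - snd q\<bar> < \<delta>"
        using that dist_fst_le[of p q] dist_snd_le[of p q] by (simp_all add: dist_real_def)
      from close[OF this] show ?thesis by simp
    qed
    then show ?thesis using \<delta>(1) by blast
  qed
  have tight: "\<exists>R. \<forall>n p. R \<le> norm p \<longrightarrow> norm (E\<omega> n p) < e" if e: "e > 0" for e
  proof -
    define \<eta> where "\<eta> = e * d\<^sup>2 / (M + 1)"
    have \<eta>: "\<eta> > 0" using e d(1) M(1) by (simp add: \<eta>_def)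
    obtain R where R: "\<And>s. R \<le> norm s \<Longrightarrow> dist (N s) 0 < \<eta>"
      using tendstoD[OF K0_kernel_column_norm(2)[OF T_kernel] \<eta>]
      unfolding eventually_at_infinity N_def by auto
    have small: "N s \<le> \<eta>" if "R \<le> \<bar>s\<bar>" for s using R[of s] that by (simp add: dist_norm)
    have far: "norm (E\<omega> n (s, t)) < e" if st: "2 * \<bar>R\<bar> \<le> norm (s, t)" for n s t
    proof -
      have "norm (s, t) \<le> \<bar>s\<bar> + \<bar>t\<bar>" using norm_Pair_le[of s t] by simp
      then have "R \<le> \<bar>s\<bar> \<or> R \<le> \<bar>t\<bar>" using st by linarith
      then have "N s * N t \<le> \<eta> * M"
      proof
        assume "R \<le> \<bar>s\<bar>"
        then show ?thesis using small M(2)[of t] N_nonneg \<eta> by (intro mult_mono) auto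
      next
        assume "R \<le> \<bar>t\<bar>"
        then have "N t * N s \<le> \<eta> * M" using small M(2)[of s] N_nonneg \<eta> by (intro mult_mono) auto
        then show ?thesis by (simp add: mult.commute)
      qed
      then have "N s / d * (N t / d) \<le> \<eta> * M / d\<^sup>2"
        by (simp add: power2_eq_square divide_right_mono)
      also have "\<dots> = e * (M / (M + 1))" using d(1) by (simp add: \<eta>_def)
      also have "\<dots> < e" using e M(1) by (simp add: field_simps)
      finally show ?thesis using bound[of n s t] by linarith
    qed
    then show ?thesis by (intro exI[of _ "2 * \<bar>R\<bar>"]) auto
  qed
  have sub: "\<exists>r. strict_mono r \<and> C0_converges (\<lambda>k. E\<omega> (m (r k)))" for m :: "nat \<Rightarrow> nat"
  proof (rule C0_converges_subsequence)
    show "norm (E\<omega> (m k) p) \<le> M / d * (M / d)" for k p by (rule bounded)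
    show "\<exists>\<delta>>0. \<forall>k p q. dist p q < \<delta> \<longrightarrow> norm (E\<omega> (m k) p - E\<omega> (m k) q) < e" if "0 < e" for e
      using equicontinuous[OF that] by auto
    show "\<exists>R. \<forall>k p. R \<le> norm p \<longrightarrow> norm (E\<omega> (m k) p) < e" if "0 < e" for e
      using tight[OF that] by auto
  qed
  moreover have "range E\<omega> \<subseteq> C0" using E\<omega>_kernel by (auto simp: K0_kernel_def)
  moreover have "\<exists>r. strict_mono r \<and> C0_converges (\<lambda>k. F (r k))" if "range F \<subseteq> range E\<omega>" for F :: "nat \<Rightarrow> real \<times> real \<Rightarrow> complex"
  proof -
    have "\<forall>k. \<exists>m. F k = E\<omega> m" using that by blast
    then obtain m where "\<And>k. F k = E\<omega> (m k)" by metis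
    then show ?thesis using sub[of m] by simp
  qed
  ultimately show ?thesis unfolding C0_relatively_compact_def by blast
qed

end
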